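(* There is no counterexample to Wilf's conjecture up to genus $60$: all numerical semigroups $S$ of genus $g(S)\le 60$ satisfy the relation $$\operatorname{card}(\operatorname{Irr}(S))\ \ge\ \frac{c(S)}{c(S)-g(S)}.$$
   Context: Here $\mathbb{N}=\{0,1,2,\dots\}$. A numerical semigroup is a subset $S\subseteq\mathbb{N}$ containing $0$, closed under addition, with finite complement in $\mathbb{N}$. Its genus is $g(S)=\operatorname{card}(\mathbb{N}\setminus S)$, its Frobenius is $f(S)=\max(\mathbb{Z}\setminus S)$ and its conductor is $c(S)=f(S)+1$. A non-zero element of $S$ is irreducible if it cannot be expressed as a sum of two non-zero elements of $S$; $\operatorname{Irr}(S)$ is the (finite) set of all irreducible elements of $S$. Wilf's conjecture (1978) is the assertion that all numerical semigroups $S$ satisfy $\operatorname{card}(\operatorname{Irr}(S))\ge \frac{c(S)}{c(S)-g(S)}$. The result was obtained by a computer exploration of the numerical semigroups of genus at most $60$. *)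

theory Defs
  imports Complex_Main
begin

definition numerical_semigroup :: "nat set \<Rightarrow> bool" where
  "numerical_semigroup S \<longleftrightarrow>
     0 \<in> S \<and> (\<forall>a\<in>S. \<forall>b\<in>S. a + b \<in> S) \<and> finite (UNIV - S)"

definition genus :: "nat set \<Rightarrow> nat" where
  "genus S = card (UNIV - S)"

text \<open>
  The maximum is taken in the integers, so the Frobenius number of the full set of natural
  numbers is -1 and its conductor is 0. Since the complement of S in the integers is not
  bounded below, it is infinite and \<^const>\<open>Max\<close> would be meaningless on it.
\<close>

definition frobenius :: "nat set \<Rightarrow> int" where
  "frobenius S = (GREATEST z. z \<notin> int ` S)"

definition conductor :: "nat set \<Rightarrow> int" where
  "conductor S = frobenius S + 1"

definition Irr :: "nat set \<Rightarrow> nat set" where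
  "Irr S = {x \<in> S. x \<noteq> 0 \<and> \<not> (\<exists>a\<in>S. \<exists>b\<in>S. a \<noteq> 0 \<and> b \<noteq> 0 \<and> x = a + b)}"

lemma frobenius_is_greatest:
  assumes "numerical_semigroup S"
  shows "frobenius S \<notin> int ` S" and "z \<notin> int ` S \<Longrightarrow> z \<le> frobenius S"
proof -
  let ?A = "insert (-1) (int ` (UNIV - S))"
  have fin: "finite ?A"
    using assms by (simp add: numerical_semigroup_def)
  have notin: "Max ?A \<notin> int ` S"
    using Max_in[OF fin] by auto
  have upper: "z \<le> Max ?A" if "z \<notin> int ` S" for z
  proof (cases "z < 0")
    case True
    then have "z \<le> -1" by simp
    also have "-1 \<le> Max ?A" using fin by (intro Max_ge) auto
    finally show ?thesis .
  next
    case False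
    then have "z = int (nat z)" by simp
    with that have "z \<in> ?A" by (metis Diff_iff UNIV_I image_eqI insertCI)
    with fin show ?thesis by (rule Max_ge)
  qed
  have "frobenius S = Max ?A"
    unfolding frobenius_def using notin upper by (rule Greatest_equality)
  with notin upper show "frobenius S \<notin> int ` S" "z \<notin> int ` S \<Longrightarrow> z \<le> frobenius S"
    by simp_all
qed

text \<open>
  The full set of natural numbers is the only numerical semigroup for which the denominator
  of Wilf's quotient vanishes. There the quotient 0 / 0 is 0 by the library's convention, and
  the inequality holds.
\<close>

lemma conductor_UNIV: "conductor UNIV = 0"
proof -
  have "frobenius UNIV = -1"
    unfolding frobenius_def
  proof (rule Greatest_equality)
    show "z \<le> -1" if "z \<notin> range int" for z :: int
      using that by (metis int_one_le_iff_zero_less nonneg_int_cases not_le rangeI zle_add1_eq_le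
          add.commute add.right_inverse)
  qed auto
  then show ?thesis by (simp add: conductor_def)
qed

lemma finite_Irr:
  assumes "numerical_semigroup S"
  shows "finite (Irr S)"
proof -
  have fin: "finite (UNIV - S)"
    using assms by (simp add: numerical_semigroup_def)
  then obtain k where k: "\<And>x. x \<notin> S \<Longrightarrow> x \<le> k"
    by (meson DiffI UNIV_I finite_nat_set_iff_bounded_le)
  then have big: "x \<in> S" if "x > k" for x
    using that not_le by blast
  have "x \<le> 2 * Suc k" if "x \<in> Irr S" for x
  proof (rule ccontr)
    assume "\<not> x \<le> 2 * Suc k"
    then have "x = Suc k + (x - Suc k)" "x - Suc k > k" by auto
    moreover have "Suc k \<in> S" "x - Suc k \<in> S"
      using big calculation(2) by auto
    ultimately show False
      using that unfolding Irr_def by (metis (mono_tags, lifting) mem_Collect_eq gr_implies_not0 nat.simps(3))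
  qed
  then show ?thesis
    using finite_nat_set_iff_bounded_le by blast
qed

end

theory Submission
  imports Defs
begin

text \<open>
  Let $m$ be the least non-zero element of $S$, let $c$ be the conductor, $n$ the number of elements
  of $S$ below $c$, and $g$ the genus. Then $c = g + n$, and the claim is $c \le e n$ for the number
  $e$ of irreducible elements. If $n \ge g$, it follows from $e \ge 2$, and if $c \le 2m$, from a short
  count of sums of two elements (wilf_low). What remains has $n < g \le 60$, hence $c < 120$
  and $m < 60$.

  Let $G$ be the monoid generated by the $k$ irreducible elements below $c$. It agrees with $S$ below
  $c$, and the elements of $[c, c + m)$ outside $G$ are irreducible. If $G$ reaches $h$ residues
  modulo $m$ below $c + m$, then $e \ge k + (m - h)$, so a counterexample satisfies
  $(k + (m - h)) n < c \le 60 + n$: there are few irreducible and few small elements, but the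
  sums of the latter reach almost all residues.

  These demands conflict so strongly that a search tree over the generators, taken in increasing
  order, remains small. Let $h(t)$ be the number of residues that $G$ reaches below $t$. Adjoining a
  generator $z \ge x$ gives a count $h'$ with $h'(t) \le h(t) + h'(t - x)$
  (hits_adjoin). Iterated $s$ times, this bounds the residues that can be reached with $s$
  further generators, all at least $x$, whatever they are (hits_extend), while $k$ and $n$
  grow by at least $s$ (below_extend). If the resulting inequality excludes a counterexample
  for every $s$, then no generator from $x$ on needs to be tried. With this pruning the tree consists
  of about eleven thousand monoids. The lemma node_sound says that the search covers all
  sequences of generators, and the lemmas runs_90_2 to runs_120_40 evaluate it by
  rewriting with its defining equations.
\<close>

section \<open>Monoids with a multiplicity\<close>

definition monoid_with :: "nat \<Rightarrow> nat set \<Rightarrow> bool" where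
  "monoid_with m G \<longleftrightarrow> 0 < m \<and> 0 \<in> G \<and> m \<in> G \<and> (\<forall>a\<in>G. \<forall>b\<in>G. a + b \<in> G)"

definition adjoin :: "nat set \<Rightarrow> nat \<Rightarrow> nat set" where
  "adjoin G z = {g + i * z | g i. g \<in> G}"

primrec extend :: "nat set \<Rightarrow> nat list \<Rightarrow> nat set" where
  "extend G [] = G"
| "extend G (z # zs) = extend (adjoin G z) zs"

primrec independent :: "nat set \<Rightarrow> nat list \<Rightarrow> bool" where
  "independent G [] \<longleftrightarrow> True"
| "independent G (z # zs) \<longleftrightarrow> z \<notin> G \<and> independent (adjoin G z) zs"

definition below :: "nat set \<Rightarrow> nat \<Rightarrow> nat" where
  "below G t = card {g \<in> G. g < t}"

text \<open>
  The residues modulo the multiplicity $m$ that a monoid reaches below $t$. For $t = c + m$ this is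
  the number of elements of $G$ in $[c, c + m)$, because $m \in G$: a residue, once reached, stays
  reached. Counting residues instead of elements is what makes the growth bound below possible.
\<close>

definition hits :: "nat \<Rightarrow> nat set \<Rightarrow> nat \<Rightarrow> nat" where
  "hits m G t = card ((\<lambda>g. g mod m) ` {g \<in> G. g < t})"

definition apery :: "nat \<Rightarrow> nat set \<Rightarrow> nat \<Rightarrow> bool" where
  "apery m G w \<longleftrightarrow> w \<in> G \<and> (m \<le> w \<longrightarrow> w - m \<notin> G)"

lemma monoid_with_mult:
  assumes "monoid_with m G" "g \<in> G" "h \<in> G"
  shows "g + i * h \<in> G"
proof (induction i)
  case 0 show ?case using assms by simp
next
  case (Suc i)
  have "(g + i * h) + h \<in> G" using Suc assms unfolding monoid_with_def by blast
  then show ?case by (simp add: algebra_simps)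
qed

lemma adjoin_superset: "G \<subseteq> adjoin G z"
  unfolding adjoin_def by (force intro: exI[of _ "0::nat"])

lemma adjoin_monoid:
  assumes "monoid_with m G" shows "monoid_with m (adjoin G z)"
proof -
  have "a + b \<in> adjoin G z" if "a \<in> adjoin G z" "b \<in> adjoin G z" for a b
  proof -
    from that obtain g i h j where "a = g + i * z" "g \<in> G" "b = h + j * z" "h \<in> G"
      unfolding adjoin_def by blast
    then have "a + b = (g + h) + (i + j) * z" "g + h \<in> G"
      using assms by (auto simp: algebra_simps monoid_with_def)
    then show ?thesis unfolding adjoin_def by blast
  qed
  moreover have "0 \<in> adjoin G z" "m \<in> adjoin G z" "0 < m"
    using adjoin_superset[of G z] assms by (auto simp: monoid_with_def)
  ultimately show ?thesis by (simp add: monoid_with_def)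
qed

lemma mem_adjoin: "monoid_with m G \<Longrightarrow> z \<in> adjoin G z"
  unfolding adjoin_def monoid_with_def by (force intro: exI[of _ "1::nat"] exI[of _ "0::nat"])

lemma adjoin_cases:
  assumes "h \<in> adjoin G z" "h \<notin> G"
  obtains h' where "h = z + h'" "h' \<in> adjoin G z"
proof -
  from assms(1) obtain g i where *: "h = g + i * z" "g \<in> G" by (auto simp: adjoin_def)
  with assms(2) obtain j where "i = Suc j" by (cases i) auto
  with * have "h = z + (g + j * z)" "g + j * z \<in> adjoin G z" by (auto simp: adjoin_def)
  then show ?thesis by (rule that)
qed

lemma extend_superset: "G \<subseteq> extend G zs"
  by (induction zs arbitrary: G) (use adjoin_superset in \<open>simp; blast\<close>)+

lemma extend_monoid: "monoid_with m G \<Longrightarrow> monoid_with m (extend G zs)"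
  by (induction zs arbitrary: G) (auto intro: adjoin_monoid)

lemma mem_extend: "monoid_with m G \<Longrightarrow> z \<in> set zs \<Longrightarrow> z \<in> extend G zs"
proof (induction zs arbitrary: G)
  case (Cons y ys)
  then show ?case
    using mem_adjoin[of m G y] adjoin_monoid[of m G y] extend_superset[of "adjoin G y" ys] by auto
qed simp

text \<open>
  Each independent generator below $c$ is itself a new element below $c$. This is the only growth of
  the number of small elements that the search uses.
\<close>

lemma below_extend:
  assumes "independent G zs" "\<forall>z\<in>set zs. z < c" "monoid_with m G"
  shows "below G c + length zs \<le> below (extend G zs) c"
  using assms
proof (induction zs arbitrary: G)
  case (Cons z zs)
  have "insert z {g \<in> G. g < c} \<subseteq> {g \<in> adjoin G z. g < c}"
    using Cons.prems mem_adjoin[of m G z] adjoin_superset[of G z] by auto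
  then have "card (insert z {g \<in> G. g < c}) \<le> below (adjoin G z) c"
    unfolding below_def by (intro card_mono) auto
  moreover have "card (insert z {g \<in> G. g < c}) = below G c + 1"
    using Cons.prems by (simp add: below_def)
  moreover have "below (adjoin G z) c + length zs \<le> below (extend (adjoin G z) zs) c"
    using Cons.IH[of "adjoin G z"] Cons.prems adjoin_monoid by auto
  ultimately show ?case by simp
qed simp

lemma hits_0: "hits m G 0 = 0" by (simp add: hits_def)

lemma hits_mono: "s \<le> t \<Longrightarrow> hits m G s \<le> hits m G t"
  unfolding hits_def by (intro card_mono) auto

text \<open>
  A residue is reached for the first time exactly at an Apery element, so the function
  $t \mapsto$ \<^term>\<open>hits m G t\<close> is the counting function of the Apery set.
\<close>

lemma hits_Suc:
  assumes "monoid_with m G"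
  shows "hits m G (Suc t) = hits m G t + (if apery m G t then 1 else 0)"
proof (cases "t \<in> G")
  case False
  then have "{g \<in> G. g < Suc t} = {g \<in> G. g < t}" using less_Suc_eq by auto
  with False show ?thesis by (simp add: hits_def apery_def)
next
  case True
  then have eq: "{g \<in> G. g < Suc t} = insert t {g \<in> G. g < t}" by auto
  have "t mod m \<in> (\<lambda>g. g mod m) ` {g \<in> G. g < t} \<longleftrightarrow> \<not> apery m G t"
  proof
    assume "t mod m \<in> (\<lambda>g. g mod m) ` {g \<in> G. g < t}"
    then obtain g where g: "g \<in> G" "g < t" "g mod m = t mod m" by force
    then obtain j where j: "t = g + m * j" by (metis less_imp_le mod_eq_nat1E)
    with g obtain i where "j = Suc i" by (cases j) auto
    with j have "t - m = g + i * m" "m \<le> t" by auto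
    with g monoid_with_mult[OF assms, of g m i] True assms show "\<not> apery m G t"
      by (auto simp: apery_def monoid_with_def)
  next
    assume "\<not> apery m G t"
    with True have "m \<le> t" "t - m \<in> G" by (auto simp: apery_def)
    moreover have "0 < m" using assms by (simp add: monoid_with_def)
    ultimately have "(t - m) mod m = t mod m" "t - m < t" by (auto simp: le_mod_geq)
    with \<open>t - m \<in> G\<close> show "t mod m \<in> (\<lambda>g. g mod m) ` {g \<in> G. g < t}"
      by (metis (mono_tags, lifting) image_eqI mem_Collect_eq)
  qed
  then show ?thesis by (simp add: hits_def eq card_insert_if)
qed

text \<open>
  The value at $t$ is $B(t) + B(t - x) + B(t - 2x) + \dots$ with $x = y + 1$. The shift by one keeps
  the recursion terminating without a side condition.
\<close>

fun cumulate :: "nat \<Rightarrow> (nat \<Rightarrow> nat) \<Rightarrow> nat \<Rightarrow> nat" where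
  "cumulate y B t = B t + (if t \<le> y then 0 else cumulate y B (t - Suc y))"

declare cumulate.simps [simp del]

text \<open>
  The key estimate. An element of \<^term>\<open>adjoin G z\<close> below $t$ lies in $G$ or is $z$ plus a smaller
  element, hence $h'(t) \le h(t) + h'(t - z)$ for the residue counts $h$ of $G$ and $h'$ of
  \<^term>\<open>adjoin G z\<close>. Since $h'$ is monotone, $z$ may be replaced by any lower bound of it, which
  turns the estimate into one that holds for all later generators at once.
\<close>

lemma hits_adjoin:
  assumes "monoid_with m G" "y < z"
  shows "hits m (adjoin G z) t \<le> cumulate y (hits m G) t"
proof (induction t rule: less_induct)
  case (less t)
  let ?r = "\<lambda>g. g mod m"
  let ?A = "?r ` {g \<in> G. g < t}"
  let ?B = "?r ` {g \<in> adjoin G z. g < t - z}"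
  have "?r ` {g \<in> adjoin G z. g < t} \<subseteq> ?A \<union> (\<lambda>r. (z + r) mod m) ` ?B"
  proof
    fix r assume "r \<in> ?r ` {g \<in> adjoin G z. g < t}"
    then obtain h where h: "h \<in> adjoin G z" "h < t" "r = h mod m" by auto
    show "r \<in> ?A \<union> (\<lambda>r. (z + r) mod m) ` ?B"
    proof (cases "h \<in> G")
      case False
      from adjoin_cases[OF h(1) this] obtain h' where h': "h = z + h'" "h' \<in> adjoin G z" .
      with h have "h' mod m \<in> ?B" "r = (z + h' mod m) mod m" by (auto simp: mod_simps)
      then show ?thesis by blast
    qed (use h in auto)
  qed
  then have "hits m (adjoin G z) t \<le> card (?A \<union> (\<lambda>r. (z + r) mod m) ` ?B)"
    unfolding hits_def by (rule card_mono[rotated]) auto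
  also have "\<dots> \<le> card ?A + card ((\<lambda>r. (z + r) mod m) ` ?B)" by (rule card_Un_le)
  also have "\<dots> \<le> hits m G t + hits m (adjoin G z) (t - z)"
    unfolding hits_def using card_image_le[of ?B "\<lambda>r. (z + r) mod m"] by simp
  finally have step: "hits m (adjoin G z) t \<le> hits m G t + hits m (adjoin G z) (t - z)" .
  show ?case
  proof (cases "t \<le> y")
    case True
    with assms step show ?thesis by (simp add: cumulate.simps[of _ _ t] hits_0)
  next
    case False
    have "hits m (adjoin G z) (t - z) \<le> hits m (adjoin G z) (t - Suc y)"
      using assms by (intro hits_mono) auto
    with False step less.IH[of "t - Suc y"] show ?thesis
      by (simp add: cumulate.simps[of _ _ t])
  qed
qed

lemma cumulate_mono: "(\<And>s. A s \<le> B s) \<Longrightarrow> cumulate y A t \<le> cumulate y B t"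
  by (induction t rule: less_induct) (subst (1 2) cumulate.simps, auto intro!: add_mono)

lemma cumulate_iter_mono: "(\<And>s. A s \<le> B s) \<Longrightarrow> (cumulate y ^^ k) A t \<le> (cumulate y ^^ k) B t"
  by (induction k arbitrary: t) (auto intro: cumulate_mono)

lemma hits_extend:
  assumes "monoid_with m G" "\<forall>z\<in>set zs. y < z"
  shows "hits m (extend G zs) t \<le> (cumulate y ^^ length zs) (hits m G) t"
  using assms
proof (induction zs arbitrary: G)
  case (Cons z zs)
  have "hits m (extend (adjoin G z) zs) t \<le> (cumulate y ^^ length zs) (hits m (adjoin G z)) t"
    using Cons adjoin_monoid by simp
  also have "\<dots> \<le> (cumulate y ^^ length zs) (cumulate y (hits m G)) t"
    using Cons.prems by (intro cumulate_iter_mono hits_adjoin) auto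
  also have "\<dots> = (cumulate y ^^ length (z # zs)) (hits m G) t"
    by (simp add: funpow_swap1)
  finally show ?case by simp
qed simp

text \<open>
  Here $k$ counts the irreducible elements below $c$, and \<^term>\<open>m - hits m G (c + m)\<close> those elements
  of $[c, c + m)$ that $G$ does not reach, which are irreducible as well. The product is therefore a
  lower bound for the number of irreducible elements times the number of elements below $c$.
\<close>

definition wilf_at :: "nat \<Rightarrow> nat \<Rightarrow> nat set \<Rightarrow> nat \<Rightarrow> bool" where
  "wilf_at m k G c \<longleftrightarrow> c \<le> (k + (m - hits m G (c + m))) * below G c"

section \<open>The search\<close>

text \<open>
  Sets of natural numbers are bit strings whose constructors carry the bit. The functions of the search are
  evaluated by rewriting, which evaluates every argument of a function before the function itself.
  A conditional would therefore evaluate both branches. This is why many definitions come with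
  auxiliary functions that receive an already evaluated condition or number as an argument, and with
  code equations that match on it.
\<close>

datatype bits = End | Out bits | In bits

fun or_bits :: "bits \<Rightarrow> bits \<Rightarrow> bits" where
  "or_bits End M = End"
| "or_bits (Out L) End = Out L"
| "or_bits (In L) End = In L"
| "or_bits (Out L) (Out M) = Out (or_bits L M)"
| "or_bits (Out L) (In M) = In (or_bits L M)"
| "or_bits (In L) (Out M) = In (or_bits L M)"
| "or_bits (In L) (In M) = In (or_bits L M)"

fun or_shift :: "nat \<Rightarrow> bits \<Rightarrow> bits \<Rightarrow> bits" where
  "or_shift 0 L M = or_bits L M"
| "or_shift (Suc s) End M = End"
| "or_shift (Suc s) (Out L) M = Out (or_shift s L M)"
| "or_shift (Suc s) (In L) M = In (or_shift s L M)"

text \<open>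
  The shift doubles in every round, so that $p$ rounds account for all multiples $jz$ with $j < 2^p$.
\<close>

primrec adjoin_bits :: "nat \<Rightarrow> nat \<Rightarrow> bits \<Rightarrow> bits" where
  "adjoin_bits 0 z L = L"
| "adjoin_bits (Suc p) z L = adjoin_bits p (z + z) (or_shift z L L)"

fun drop_bits :: "nat \<Rightarrow> bits \<Rightarrow> bits" where
  "drop_bits 0 L = L"
| "drop_bits (Suc n) End = End"
| "drop_bits (Suc n) (Out L) = drop_bits n L"
| "drop_bits (Suc n) (In L) = drop_bits n L"

text \<open>
  The string holds the Apery bits of the numbers below some $t$, largest number first, and $b$ is the
  number of its \<^const>\<open>In\<close> bits. With $i = 0$ the result lists the residue counts at $t$,
  $t - x$, $t - 2x$, \dots for $x = y + 1$, the terms of \<^const>\<open>cumulate\<close>.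
\<close>

primrec strides :: "nat \<Rightarrow> bits \<Rightarrow> nat \<Rightarrow> nat \<Rightarrow> nat list" where
  "strides y End i b = []"
| "strides y (Out r) i b =
    (case i of 0 \<Rightarrow> b # strides y r y b | Suc j \<Rightarrow> strides y r j b)"
| "strides y (In r) i b =
    (case i of 0 \<Rightarrow> b # strides y r y (b - 1) | Suc j \<Rightarrow> strides y r j (b - 1))"

lemma strides_code [code]:
  "strides y End i b = []"
  "strides y (In r) (Suc i) (Suc b) = strides y r i b"
  "strides y (Out r) (Suc i) b = strides y r i b"
  "strides y (In r) 0 (Suc b) = Suc b # strides y r y b"
  "strides y (Out r) 0 b = b # strides y r y b"
  by simp_all

text \<open>
  Subtracts from the last argument the $s$-fold iterate of \<^const>\<open>cumulate\<close> at the start of the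
  stride. Subtracting term by term stops as soon as zero is reached, so the usually large iterate is
  never computed.
\<close>

fun minus_iter :: "nat \<Rightarrow> nat list \<Rightarrow> nat \<Rightarrow> nat" where
  "minus_iter s v 0 = 0"
| "minus_iter s [] (Suc n) = Suc n"
| "minus_iter 0 (a # v) (Suc n) = Suc n - a"
| "minus_iter (Suc s) (a # v) (Suc n) = minus_iter (Suc s) v (minus_iter s (a # v) (Suc n))"

primrec some_need :: "nat list \<Rightarrow> nat \<Rightarrow> nat list \<Rightarrow> bool" where
  "some_need [] s v = False"
| "some_need (q # qs) s v = (minus_iter s v q = 0 \<or> some_need qs (Suc s) v)"

definition some_need1 :: "nat \<Rightarrow> nat list \<Rightarrow> nat \<Rightarrow> nat list \<Rightarrow> bool" where
  "some_need1 q qs s v = (q = 0 \<or> some_need qs (Suc s) v)"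

lemma some_need_code [code]:
  "some_need [] s v = False"
  "some_need (q # qs) s v = some_need1 (minus_iter s v q) qs s v"
  "some_need1 0 qs s v = True"
  "some_need1 (Suc q) qs s v = some_need qs (Suc s) v"
  by (simp_all add: some_need1_def)

text \<open>
  With $P = er$ and $er < c$, the least $b$ such that $(e + (m - b)) r < c$: the number of residues
  that have to be reached for $e$ irreducible elements below $c$ and $r$ elements below $c$ to
  violate the inequality.
\<close>

primrec need :: "nat \<Rightarrow> int \<Rightarrow> int \<Rightarrow> int \<Rightarrow> nat" where
  "need 0 c r P = 0"
| "need (Suc m) c r P = (if P + r < c then need m c r (P + r) else Suc m)"

definition need1 :: "nat \<Rightarrow> int \<Rightarrow> int \<Rightarrow> int \<Rightarrow> nat" where
  "need1 m c r P = (if P < c then need m c r P else Suc m)"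

definition need2 :: "bool \<Rightarrow> nat \<Rightarrow> int \<Rightarrow> int \<Rightarrow> int \<Rightarrow> nat" where
  "need2 q m c r P = (if q then need m c r P else Suc m)"

lemma need_code [code]:
  "need 0 c r P = 0"
  "need (Suc m) c r P = need1 m c r (P + r)"
  "need1 m c r P = need2 (P < c) m c r P"
  "need2 True m c r P = need m c r P"
  "need2 False m c r P = Suc m"
  by (simp_all add: need1_def need2_def)

text \<open>
  The thresholds for one, two, three, \dots further generators, which raise $k$ and $n$ by one each.
  The number of elements below $c$ is also at least $rm = c - 60$, because the genus is at most 60.
  The list stops when $k \cdot \max(n, rm) \ge c$, after which no violation is possible. When the fuel
  runs out, the threshold $0$ errs on the safe side.
\<close>

primrec needs :: "nat \<Rightarrow> nat \<Rightarrow> int \<Rightarrow> int \<Rightarrow> int \<Rightarrow> int \<Rightarrow> nat list" where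
  "needs 0 m c rm k n = [0]"
| "needs (Suc f) m c rm k n =
    (if k * max n rm < c then need m c (max n rm) (k * max n rm) # needs f m c rm (k + 1) (n + 1)
     else [])"

definition needs1 :: "int \<Rightarrow> nat \<Rightarrow> nat \<Rightarrow> int \<Rightarrow> int \<Rightarrow> int \<Rightarrow> int \<Rightarrow> nat list" where
  "needs1 r f m c rm k n =
    (if k * r < c then need m c r (k * r) # needs f m c rm (k + 1) (n + 1) else [])"

definition needs2 :: "int \<Rightarrow> int \<Rightarrow> nat \<Rightarrow> nat \<Rightarrow> int \<Rightarrow> int \<Rightarrow> int \<Rightarrow> int \<Rightarrow> nat list" where
  "needs2 P r f m c rm k n =
    (if P < c then need m c r P # needs f m c rm (k + 1) (n + 1) else [])"

definition needs3 ::
  "bool \<Rightarrow> int \<Rightarrow> int \<Rightarrow> nat \<Rightarrow> nat \<Rightarrow> int \<Rightarrow> int \<Rightarrow> int \<Rightarrow> int \<Rightarrow> nat list" where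
  "needs3 q P r f m c rm k n =
    (if q then need m c r P # needs f m c rm (k + 1) (n + 1) else [])"

lemma needs_code [code]:
  "needs 0 m c rm k n = [0]"
  "needs (Suc f) m c rm k n = needs1 (max n rm) f m c rm k n"
  "needs1 r f m c rm k n = needs2 (k * r) r f m c rm k n"
  "needs2 P r f m c rm k n = needs3 (P < c) P r f m c rm k n"
  "needs3 True P r f m c rm k n = need m c r P # needs f m c rm (k + 1) (n + 1)"
  "needs3 False P r f m c rm k n = []"
  by (simp_all add: needs1_def needs2_def needs3_def)

text \<open>
  The number of consecutive candidates $x, x + 1, \dots$ for the least new generator that the bound
  cannot exclude. Elements of the monoid are counted without a test, since the search never adjoins
  them.
\<close>

primrec reach :: "bits \<Rightarrow> int \<Rightarrow> nat \<Rightarrow> int \<Rightarrow> nat list \<Rightarrow> nat \<Rightarrow> bits \<Rightarrow> nat" where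
  "reach End x y c qs b r = 0"
| "reach (In L) x y c qs b r = Suc (reach L (x + 1) (Suc y) c qs b r)"
| "reach (Out L) x y c qs b r =
    (if x < c \<and> some_need qs 1 (strides y r 0 b)
     then Suc (reach L (x + 1) (Suc y) c qs b r) else 0)"

definition reach1 :: "bool \<Rightarrow> bits \<Rightarrow> int \<Rightarrow> nat \<Rightarrow> int \<Rightarrow> nat list \<Rightarrow> nat \<Rightarrow> bits \<Rightarrow> nat" where
  "reach1 q L x y c qs b r =
    (if q \<and> some_need qs 1 (strides y r 0 b)
     then Suc (reach L (x + 1) (Suc y) c qs b r) else 0)"

definition reach2 :: "bool \<Rightarrow> bits \<Rightarrow> int \<Rightarrow> nat \<Rightarrow> int \<Rightarrow> nat list \<Rightarrow> nat \<Rightarrow> bits \<Rightarrow> nat" where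
  "reach2 q L x y c qs b r = (if q then Suc (reach L (x + 1) (Suc y) c qs b r) else 0)"

lemma reach_code [code]:
  "reach End x y c qs b r = 0"
  "reach (In L) x y c qs b r = Suc (reach L (x + 1) (Suc y) c qs b r)"
  "reach (Out L) x y c qs b r = reach1 (x < c) L x y c qs b r"
  "reach1 False L x y c qs b r = 0"
  "reach1 True L x y c qs b r = reach2 (some_need qs 1 (strides y r 0 b)) L x y c qs b r"
  "reach2 False L x y c qs b r = 0"
  "reach2 True L x y c qs b r = Suc (reach L (x + 1) (Suc y) c qs b r)"
  by (simp_all add: reach1_def reach2_def)

text \<open>
  One position for every conductor $c$, counted from zero. A live position carries $c$ and the
  number of candidates for the next generator that are still to be considered for this $c$. Handling
  all conductors together means that every monoid is computed only once.
\<close>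

datatype entries = Nil_e | Skip entries | Fail entries | Live int nat entries

text \<open>
  A conductor $c$ is dropped if $c - 1$ belongs to the monoid or if $kn \ge c$, for neither changes
  when the monoid grows. \<^const>\<open>Fail\<close> records that the monoid itself violates the inequality.
\<close>

definition entry ::
  "int \<Rightarrow> bool \<Rightarrow> bits \<Rightarrow> int \<Rightarrow> nat \<Rightarrow> int \<Rightarrow> nat \<Rightarrow> int \<Rightarrow> nat \<Rightarrow> bits \<Rightarrow> entries \<Rightarrow> entries" where
  "entry c prev L x y k m n b r es =
    (if prev \<or> c \<le> k * n then Skip es
     else if c - n \<le> 60 \<and> need m c n (k * n) \<le> b then Fail es
     else Live c (reach L x y c (needs 9 m c (c - 60) (k + 1) (n + 1)) b r) es)"

definition entry1 ::
  "int \<Rightarrow> int \<Rightarrow> bits \<Rightarrow> int \<Rightarrow> nat \<Rightarrow> int \<Rightarrow> nat \<Rightarrow> int \<Rightarrow> nat \<Rightarrow> bits \<Rightarrow> entries \<Rightarrow> entries" where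
  "entry1 P c L x y k m n b r es =
    (if c \<le> P then Skip es
     else if c - n \<le> 60 \<and> need m c n P \<le> b then Fail es
     else Live c (reach L x y c (needs 9 m c (c - 60) (k + 1) (n + 1)) b r) es)"

definition entry2 ::
  "bool \<Rightarrow> int \<Rightarrow> int \<Rightarrow> bits \<Rightarrow> int \<Rightarrow> nat \<Rightarrow> int \<Rightarrow> nat \<Rightarrow> int \<Rightarrow> nat \<Rightarrow> bits \<Rightarrow> entries \<Rightarrow> entries" where
  "entry2 q P c L x y k m n b r es =
    (if q then Skip es
     else if c - n \<le> 60 \<and> need m c n P \<le> b then Fail es
     else Live c (reach L x y c (needs 9 m c (c - 60) (k + 1) (n + 1)) b r) es)"

definition entry3 ::
  "bool \<Rightarrow> nat \<Rightarrow> int \<Rightarrow> bits \<Rightarrow> int \<Rightarrow> nat \<Rightarrow> int \<Rightarrow> nat \<Rightarrow> int \<Rightarrow> nat \<Rightarrow> bits \<Rightarrow> entries \<Rightarrow> entries" where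
  "entry3 q d c L x y k m n b r es =
    (if q \<and> d = 0 then Fail es
     else Live c (reach L x y c (needs 9 m c (c - 60) (k + 1) (n + 1)) b r) es)"

lemma entry_code [code]:
  "entry c True L x y k m n b r es = Skip es"
  "entry c False L x y k m n b r es = entry1 (k * n) c L x y k m n b r es"
  "entry1 P c L x y k m n b r es = entry2 (c \<le> P) P c L x y k m n b r es"
  "entry2 True P c L x y k m n b r es = Skip es"
  "entry2 False P c L x y k m n b r es =
     entry3 (c - n \<le> 60) (need m c n P - b) c L x y k m n b r es"
  "entry3 True 0 c L x y k m n b r es = Fail es"
  "entry3 True (Suc d) c L x y k m n b r es =
     Live c (reach L x y c (needs 9 m c (c - 60) (k + 1) (n + 1)) b r) es"
  "entry3 False d c L x y k m n b r es =
     Live c (reach L x y c (needs 9 m c (c - 60) (k + 1) (n + 1)) b r) es"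
  by (simp_all add: entry_def entry1_def entry2_def entry3_def)

primrec hd_bits :: "bits \<Rightarrow> bool" where
  "hd_bits End = False" | "hd_bits (Out L) = False" | "hd_bits (In L) = True"

primrec tl_bits :: "bits \<Rightarrow> bits" where
  "tl_bits End = End" | "tl_bits (Out L) = L" | "tl_bits (In L) = L"

text \<open>
  Runs through all $c$ with the two strings $L$ and $M$ of the monoid, where $M$ is $m$ positions ahead.
  A member of $M$ is an Apery element precisely if the corresponding number in $L$ is absent. The
  arguments $n$, $b$ and $r$ are the number of elements below $c$, the residue count at $c + m$ and
  the Apery bits below $c + m$. The numbers in the live positions come from the parent node and are
  computed anew.
\<close>

primrec scan ::
  "entries \<Rightarrow> bits \<Rightarrow> bits \<Rightarrow> bool \<Rightarrow> bits \<Rightarrow> int \<Rightarrow> nat \<Rightarrow> int \<Rightarrow> nat \<Rightarrow> int \<Rightarrow> nat \<Rightarrow> bits \<Rightarrow> entries"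
where
  "scan Nil_e L M prev Lx x y k m n b r = Nil_e"
| "scan (Skip es) L M prev Lx x y k m n b r = Skip (scan es (tl_bits L) (tl_bits M) (hd_bits L)
     Lx x y k m (if hd_bits L then n + 1 else n) (if \<not> hd_bits L \<and> hd_bits M then Suc b else b)
     (if \<not> hd_bits L \<and> hd_bits M then In r else Out r))"
| "scan (Fail es) L M prev Lx x y k m n b r = Skip (scan es (tl_bits L) (tl_bits M) (hd_bits L)
     Lx x y k m (if hd_bits L then n + 1 else n) (if \<not> hd_bits L \<and> hd_bits M then Suc b else b)
     (if \<not> hd_bits L \<and> hd_bits M then In r else Out r))"
| "scan (Live c d es) L M prev Lx x y k m n b r = entry c prev Lx x y k m n b r
     (scan es (tl_bits L) (tl_bits M) (hd_bits L)
     Lx x y k m (if hd_bits L then n + 1 else n) (if \<not> hd_bits L \<and> hd_bits M then Suc b else b)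
     (if \<not> hd_bits L \<and> hd_bits M then In r else Out r))"

lemma scan_code [code]:
  "scan Nil_e L M prev Lx x y k m n b r = Nil_e"
  "scan (Skip es) (Out L) (Out M) prev Lx x y k m n b r = Skip
     (scan es L M False Lx x y k m n b (Out r))"
  "scan (Live c d es) (Out L) (Out M) prev Lx x y k m n b r = entry c prev Lx x y k m n b r
     (scan es L M False Lx x y k m n b (Out r))"
  "scan (Skip es) (Out L) (In M) prev Lx x y k m n b r = Skip
     (scan es L M False Lx x y k m n (Suc b) (In r))"
  "scan (Live c d es) (Out L) (In M) prev Lx x y k m n b r = entry c prev Lx x y k m n b r
     (scan es L M False Lx x y k m n (Suc b) (In r))"
  "scan (Skip es) (In L) (Out M) prev Lx x y k m n b r = Skip
     (scan es L M True Lx x y k m (n + 1) b (Out r))"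
  "scan (Live c d es) (In L) (Out M) prev Lx x y k m n b r = entry c prev Lx x y k m n b r
     (scan es L M True Lx x y k m (n + 1) b (Out r))"
  "scan (Skip es) (In L) (In M) prev Lx x y k m n b r = Skip
     (scan es L M True Lx x y k m (n + 1) b (Out r))"
  "scan (Live c d es) (In L) (In M) prev Lx x y k m n b r = entry c prev Lx x y k m n b r
     (scan es L M True Lx x y k m (n + 1) b (Out r))"
  by simp_all

text \<open>
  Leaves no skipped positions at the end, so that \<^const>\<open>Nil_e\<close> means that no conductor is left.
\<close>

primrec skip_trim :: "entries \<Rightarrow> entries" where
  "skip_trim Nil_e = Nil_e"
| "skip_trim (Skip es) = Skip (Skip es)"
| "skip_trim (Fail es) = Skip (Fail es)"
| "skip_trim (Live c d es) = Skip (Live c d es)"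

text \<open>
  Moves on to the next candidate: a conductor whose candidates are used up is skipped from then on.
\<close>

primrec tick :: "entries \<Rightarrow> entries" where
  "tick Nil_e = Nil_e"
| "tick (Skip es) = skip_trim (tick es)"
| "tick (Fail es) = skip_trim (tick es)"
| "tick (Live c d es) = (case d of 0 \<Rightarrow> skip_trim (tick es) | Suc d \<Rightarrow> Live c d (tick es))"

lemma tick_code [code]:
  "tick Nil_e = Nil_e"
  "tick (Skip es) = skip_trim (tick es)"
  "tick (Fail es) = skip_trim (tick es)"
  "tick (Live c 0 es) = skip_trim (tick es)"
  "tick (Live c (Suc d) es) = Live c d (tick es)"
  by simp_all

primrec no_fail :: "entries \<Rightarrow> bool" where
  "no_fail Nil_e = True"
| "no_fail (Skip es) = no_fail es"
| "no_fail (Fail es) = False"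
| "no_fail (Live c d es) = no_fail es"

text \<open>
  Tries the candidates $y + 1, y + 2, \dots$ for the next generator and hands the enlarged monoid to
  $ch$, together with the conductors that the bound left open.
\<close>

primrec explore ::
  "bits \<Rightarrow> (bits \<Rightarrow> nat \<Rightarrow> int \<Rightarrow> entries \<Rightarrow> bool) \<Rightarrow> nat \<Rightarrow> bits \<Rightarrow> nat \<Rightarrow> int \<Rightarrow> entries \<Rightarrow> bool"
where
  "explore End ch p L y x es = True"
| "explore (In Lx) ch p L y x es =
    (tick es = Nil_e \<or> explore Lx ch p L (Suc y) (x + 1) (tick es))"
| "explore (Out Lx) ch p L y x es =
    (tick es = Nil_e \<or> (ch (adjoin_bits p (Suc y) L) (Suc y) (x + 1) (tick es) \<and>
       explore Lx ch p L (Suc y) (x + 1) (tick es)))"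

definition explore_in ::
  "bits \<Rightarrow> (bits \<Rightarrow> nat \<Rightarrow> int \<Rightarrow> entries \<Rightarrow> bool) \<Rightarrow> nat \<Rightarrow> bits \<Rightarrow> nat \<Rightarrow> int \<Rightarrow> entries \<Rightarrow> bool"
where
  "explore_in Lx ch p L y x es = (es = Nil_e \<or> explore Lx ch p L (Suc y) (x + 1) es)"

definition explore_out ::
  "bits \<Rightarrow> (bits \<Rightarrow> nat \<Rightarrow> int \<Rightarrow> entries \<Rightarrow> bool) \<Rightarrow> nat \<Rightarrow> bits \<Rightarrow> nat \<Rightarrow> int \<Rightarrow> entries \<Rightarrow> bool"
where
  "explore_out Lx ch p L y x es =
    (es = Nil_e \<or> (ch (adjoin_bits p (Suc y) L) (Suc y) (x + 1) es \<and>
       explore Lx ch p L (Suc y) (x + 1) es))"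

definition explore_if ::
  "bool \<Rightarrow> bits \<Rightarrow> (bits \<Rightarrow> nat \<Rightarrow> int \<Rightarrow> entries \<Rightarrow> bool) \<Rightarrow> nat \<Rightarrow> bits \<Rightarrow> nat \<Rightarrow> int \<Rightarrow> entries \<Rightarrow> bool"
where
  "explore_if q Lx ch p L y x es = (q \<and> explore Lx ch p L y x es)"

lemma explore_code [code]:
  "explore End ch p L y x es = True"
  "explore (In Lx) ch p L y x es = explore_in Lx ch p L y x (tick es)"
  "explore (Out Lx) ch p L y x es = explore_out Lx ch p L y x (tick es)"
  "explore_in Lx ch p L y x Nil_e = True"
  "explore_in Lx ch p L y x (Skip es) = explore Lx ch p L (Suc y) (x + 1) (Skip es)"
  "explore_in Lx ch p L y x (Live c d es) = explore Lx ch p L (Suc y) (x + 1) (Live c d es)"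
  "explore_out Lx ch p L y x Nil_e = True"
  "explore_out Lx ch p L y x (Skip es) =
     explore_if (ch (adjoin_bits p (Suc y) L) (Suc y) (x + 1) (Skip es))
       Lx ch p L (Suc y) (x + 1) (Skip es)"
  "explore_out Lx ch p L y x (Live c d es) =
     explore_if (ch (adjoin_bits p (Suc y) L) (Suc y) (x + 1) (Live c d es))
       Lx ch p L (Suc y) (x + 1) (Live c d es)"
  "explore_if False Lx ch p L y x es = False"
  "explore_if True Lx ch p L y x es = explore Lx ch p L y x es"
  by (simp_all add: explore_in_def explore_out_def explore_if_def)

text \<open>
  The first argument bounds the number of generators. Exhausting it counts as a failure of the
  search, never as a success. The string $r$ holds the Apery bits below $m$,
  which are the same for all nodes.
\<close>

primrec node ::
  "nat \<Rightarrow> nat \<Rightarrow> nat \<Rightarrow> bits \<Rightarrow> int \<Rightarrow> bits \<Rightarrow> nat \<Rightarrow> int \<Rightarrow> entries \<Rightarrow> bool" where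
  "node 0 p m r k L y x es = False"
| "node (Suc f) p m r k L y x es =
    (no_fail (scan es L (drop_bits m L) False (drop_bits (Suc y) L) x y k m 0 1 r) \<and>
     explore (drop_bits (Suc y) L) (node f p m r (k + 1)) p L y x
       (scan es L (drop_bits m L) False (drop_bits (Suc y) L) x y k m 0 1 r))"

definition node1 ::
  "bits \<Rightarrow> nat \<Rightarrow> nat \<Rightarrow> nat \<Rightarrow> bits \<Rightarrow> int \<Rightarrow> bits \<Rightarrow> nat \<Rightarrow> int \<Rightarrow> entries \<Rightarrow> bool" where
  "node1 Lx f p m r k L y x es =
    (no_fail (scan es L (drop_bits m L) False Lx x y k m 0 1 r) \<and>
     explore Lx (node f p m r (k + 1)) p L y x
       (scan es L (drop_bits m L) False Lx x y k m 0 1 r))"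

definition node2 ::
  "entries \<Rightarrow> bits \<Rightarrow> (bits \<Rightarrow> nat \<Rightarrow> int \<Rightarrow> entries \<Rightarrow> bool) \<Rightarrow> nat \<Rightarrow> bits \<Rightarrow> nat \<Rightarrow> int \<Rightarrow> bool" where
  "node2 es Lx ch p L y x = (no_fail es \<and> explore Lx ch p L y x es)"

lemma node_code [code]:
  "node 0 p m r k L y x es = False"
  "node (Suc f) p m r k L y x es = node1 (drop_bits (Suc y) L) f p m r k L y x es"
  "node1 Lx f p m r k L y x es =
     node2 (scan es L (drop_bits m L) False Lx x y k m 0 1 r) Lx (node f p m r (k + 1)) p L y x"
  "node2 es Lx ch p L y x = explore_if (no_fail es) Lx ch p L y x es"
  by (simp_all add: node1_def node2_def explore_if_def)

primrec window :: "(nat \<Rightarrow> bool) \<Rightarrow> nat \<Rightarrow> nat \<Rightarrow> bits" where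
  "window f i 0 = End"
| "window f i (Suc n) = (if f i then In (window f (Suc i) n) else Out (window f (Suc i) n))"

primrec past :: "(nat \<Rightarrow> bool) \<Rightarrow> nat \<Rightarrow> bits" where
  "past f 0 = End"
| "past f (Suc t) = (if f t then In (past f t) else Out (past f t))"

primrec multiples_bits :: "nat \<Rightarrow> nat \<Rightarrow> nat \<Rightarrow> bits" where
  "multiples_bits y i 0 = End"
| "multiples_bits y i (Suc n) =
    (case i of 0 \<Rightarrow> In (multiples_bits y y n) | Suc j \<Rightarrow> Out (multiples_bits y j n))"

primrec fresh :: "nat \<Rightarrow> int \<Rightarrow> nat \<Rightarrow> entries" where
  "fresh lo c 0 = Nil_e"
| "fresh lo c (Suc n) =
    (case lo of 0 \<Rightarrow> Live c 0 (fresh 0 (c + 1) n) | Suc l \<Rightarrow> Skip (fresh l (c + 1) n))"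

lemma setup_code [code]:
  "multiples_bits y i 0 = End"
  "multiples_bits y 0 (Suc n) = In (multiples_bits y y n)"
  "multiples_bits y (Suc j) (Suc n) = Out (multiples_bits y j n)"
  "fresh lo c 0 = Nil_e"
  "fresh 0 c (Suc n) = Live c 0 (fresh 0 (c + 1) n)"
  "fresh (Suc l) c (Suc n) = Skip (fresh l (c + 1) n)"
  by simp_all

definition run :: "nat \<Rightarrow> nat \<Rightarrow> nat \<Rightarrow> nat \<Rightarrow> bool" where
  "run p lo hi m = node 9 p m (past (\<lambda>i. i = 0) m) 1 (multiples_bits (m - 1) 0 (hi + m))
     m (int m + 1) (fresh (max lo (2 * m + 1)) 0 hi)"

primrec runs :: "nat \<Rightarrow> nat \<Rightarrow> nat \<Rightarrow> nat list \<Rightarrow> bool" where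
  "runs p lo hi [] = True"
| "runs p lo hi (m # ms) = (run p lo hi m \<and> runs p lo hi ms)"

section \<open>Bit strings and the pruning bound\<close>

lemma window_cong: "(\<And>i. a \<le> i \<Longrightarrow> i < a + n \<Longrightarrow> f i = g i) \<Longrightarrow> window f a n = window g a n"
proof (induction n arbitrary: a)
  case (Suc n)
  have "window f (Suc a) n = window g (Suc a) n" by (rule Suc.IH) (use Suc.prems in auto)
  then show ?case using Suc.prems[of a] by simp
qed simp

lemma or_bits_window:
  "n \<le> n' \<Longrightarrow> or_bits (window f a n) (window g b n') = window (\<lambda>i. f i \<or> g (b + i - a)) a n"
proof (induction n arbitrary: a b n')
  case (Suc n)
  then obtain n'' where n'': "n' = Suc n''" "n \<le> n''" by (cases n') auto
  have "window (\<lambda>i. f i \<or> g (Suc b + i - Suc a)) (Suc a) n = window (\<lambda>i. f i \<or> g (b + i - a)) (Suc a) n"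
    by (rule window_cong) simp
  with Suc.IH[of n'' "Suc a" "Suc b"] n'' show ?case by simp
qed simp

lemma or_shift_window:
  "n \<le> n' \<Longrightarrow> or_shift s (window f a n) (window g b n') =
     window (\<lambda>i. f i \<or> (a + s \<le> i \<and> g (b + i - (a + s)))) a n"
proof (induction s arbitrary: a n)
  case 0
  have "window (\<lambda>i. f i \<or> g (b + i - a)) a n = window (\<lambda>i. f i \<or> (a + 0 \<le> i \<and> g (b + i - (a + 0)))) a n"
    by (rule window_cong) simp
  with 0 show ?case by (simp add: or_bits_window)
next
  case (Suc s)
  show ?case
  proof (cases n)
    case (Suc k)
    with Suc.prems Suc.IH[of k "Suc a"] show ?thesis by simp
  qed simp
qed

lemma adjoin_bits_window:
  "adjoin_bits p z (window f 0 n) = window (\<lambda>i. \<exists>j<2 ^ p. j * z \<le> i \<and> f (i - j * z)) 0 n"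
proof (induction p arbitrary: z f)
  case 0 show ?case by simp
next
  case (Suc p)
  let ?g = "\<lambda>i. f i \<or> z \<le> i \<and> f (i - z)"
  have "adjoin_bits (Suc p) z (window f 0 n) = adjoin_bits p (z + z) (window ?g 0 n)"
    by (simp add: or_shift_window)
  also have "\<dots> = window (\<lambda>i. \<exists>j<2 ^ p. j * (z + z) \<le> i \<and> ?g (i - j * (z + z))) 0 n"
    by (rule Suc.IH)
  also have "\<dots> = window (\<lambda>i. \<exists>j<2 ^ Suc p. j * z \<le> i \<and> f (i - j * z)) 0 n"
  proof (rule window_cong)
    fix i
    show "(\<exists>j<2 ^ p. j * (z + z) \<le> i \<and> ?g (i - j * (z + z))) \<longleftrightarrow>
          (\<exists>j<2 ^ Suc p. j * z \<le> i \<and> f (i - j * z))" (is "?l \<longleftrightarrow> ?r")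
    proof
      assume ?l
      then obtain j where j: "j < 2 ^ p" "j * (z + z) \<le> i" "?g (i - j * (z + z))" by blast
      show ?r
      proof (cases "f (i - j * (z + z))")
        case True
        have e: "j * (z + z) = (2 * j) * z" by simp
        from j True have "2 * j < 2 ^ Suc p \<and> (2 * j) * z \<le> i \<and> f (i - (2 * j) * z)"
          unfolding e by simp
        then show ?thesis by blast
      next
        case False
        with j have f: "z \<le> i - j * (z + z)" "f (i - j * (z + z) - z)" by auto
        have e: "j * (z + z) + z = (2 * j + 1) * z" by (simp add: algebra_simps)
        have "i - j * (z + z) - z = i - (2 * j + 1) * z" unfolding e[symmetric] by simp
        moreover have "(2 * j + 1) * z \<le> i" unfolding e[symmetric] using f j by linarith
        ultimately have "2 * j + 1 < 2 ^ Suc p \<and> (2 * j + 1) * z \<le> i \<and> f (i - (2 * j + 1) * z)"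
          using j f by simp
        then show ?thesis by blast
      qed
    next
      assume ?r
      then obtain j where j: "j < 2 ^ Suc p" "j * z \<le> i" "f (i - j * z)" by blast
      show ?l
      proof (cases "even j")
        case True
        then obtain k where k: "j = 2 * k" by blast
        have e: "j * z = k * (z + z)" using k by simp
        from j k have "k < 2 ^ p \<and> k * (z + z) \<le> i \<and> ?g (i - k * (z + z))"
          unfolding e by simp
        then show ?thesis by blast
      next
        case False
        then obtain k where k: "j = 2 * k + 1" by (blast elim: oddE)
        have e: "j * z = k * (z + z) + z" using k by (simp add: algebra_simps)
        have "i - k * (z + z) - z = i - (k * (z + z) + z)" by simp
        with j k have "k < 2 ^ p \<and> k * (z + z) \<le> i \<and> ?g (i - k * (z + z))"
          unfolding e by (simp only:) auto
        then show ?thesis by blast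
      qed
    qed
  qed
  finally show ?case .
qed

lemma adjoin_bits_adjoin:
  assumes "n \<le> 2 ^ p * z"
  shows "adjoin_bits p z (window (\<lambda>i. i \<in> G) 0 n) = window (\<lambda>i. i \<in> adjoin G z) 0 n"
  unfolding adjoin_bits_window
proof (rule window_cong)
  fix i assume "i < 0 + n"
  show "(\<exists>j<2 ^ p. j * z \<le> i \<and> i - j * z \<in> G) \<longleftrightarrow> i \<in> adjoin G z"
  proof
    assume "\<exists>j<2 ^ p. j * z \<le> i \<and> i - j * z \<in> G"
    then obtain j where "j * z \<le> i" "i - j * z \<in> G" by blast
    moreover from this have "i = (i - j * z) + j * z" by simp
    ultimately show "i \<in> adjoin G z" unfolding adjoin_def by blast
  next
    assume "i \<in> adjoin G z"
    then obtain g j where gj: "i = g + j * z" "g \<in> G" by (auto simp: adjoin_def)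
    have "j * z \<le> i" using gj by simp
    also have "i < n" using \<open>i < 0 + n\<close> by simp
    also have "n \<le> 2 ^ p * z" by (rule assms)
    finally have "j * z < 2 ^ p * z" .
    then have "j < 2 ^ p" by simp
    with gj show "\<exists>j<2 ^ p. j * z \<le> i \<and> i - j * z \<in> G" by (intro exI[of _ j]) simp
  qed
qed

lemma drop_bits_window: "drop_bits d (window f a n) = window f (a + d) (n - d)"
proof (induction d arbitrary: a n)
  case (Suc d)
  then show ?case by (cases n) simp_all
qed simp

lemma tl_bits_window: "tl_bits (window f a n) = window f (Suc a) (n - 1)"
  by (cases n) simp_all

lemma hd_bits_window: "hd_bits (window f a n) \<longleftrightarrow> 0 < n \<and> f a"
  by (cases n) simp_all

definition counts :: "(nat \<Rightarrow> bool) \<Rightarrow> (nat \<Rightarrow> nat) \<Rightarrow> bool" where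
  "counts f B \<longleftrightarrow> B 0 = 0 \<and> (\<forall>t. B (Suc t) = B t + (if f t then 1 else 0))"

lemma strides_skip:
  assumes "counts f B"
  shows "strides y (past f t) i (B t) = (if t \<le> i then [] else strides y (past f (t - i)) 0 (B (t - i)))"
proof (induction t arbitrary: i)
  case (Suc t)
  then show ?case using assms by (cases i) (auto simp: counts_def)
qed simp

lemma strides_Suc:
  assumes "counts f B"
  shows "strides y (past f (Suc t)) 0 (B (Suc t)) =
    B (Suc t) # (if t \<le> y then [] else strides y (past f (t - y)) 0 (B (t - y)))"
  using assms strides_skip[OF assms, of y t y] by (auto simp: counts_def)

lemma minus_iter_strides:
  assumes "counts f B"
  shows "minus_iter s (strides y (past f t) 0 (B t)) q = q - (cumulate y ^^ s) B t"
proof (induction s arbitrary: t q)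
  case 0
  show ?case
  proof (cases t)
    case 0
    then show ?thesis using assms by (cases q) (auto simp: counts_def)
  next
    case (Suc t')
    then show ?thesis by (cases q) (auto simp: strides_Suc[OF assms] simp del: past.simps strides.simps)
  qed
next
  case (Suc s)
  have zero: "(cumulate y ^^ k) B 0 = 0" for k
    using assms by (induction k) (auto simp: counts_def cumulate.simps[of _ _ 0])
  show ?case
  proof (induction t arbitrary: q rule: less_induct)
    case (less t)
    show ?case
    proof (cases t)
      case 0
      with zero[of "Suc s"] show ?thesis by (cases q) auto
    next
      case (Suc t')
      show ?thesis
      proof (cases q)
        case (Suc q')
        let ?v = "strides y (past f t) 0 (B t)"
        let ?w = "if t' \<le> y then [] else strides y (past f (t' - y)) 0 (B (t' - y))"
        have v: "?v = B t # ?w" using strides_Suc[OF assms] \<open>t = Suc t'\<close> by simp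
        have "minus_iter (Suc s) ?v q = minus_iter (Suc s) ?w (minus_iter s ?v q)"
          using v Suc by simp
        also have "\<dots> = minus_iter (Suc s) ?w (q - (cumulate y ^^ s) B t)"
          using Suc.IH by simp
        also have "\<dots> = (q - (cumulate y ^^ s) B t)
            - (if t \<le> y then 0 else (cumulate y ^^ Suc s) B (t - Suc y))"
        proof (cases "t' \<le> y")
          case True
          then have "t \<le> y \<or> t - Suc y = 0" using \<open>t = Suc t'\<close> by auto
          with True zero[of "Suc s"] show ?thesis
            by (cases "q - (cumulate y ^^ s) B t") (auto simp del: funpow.simps)
        next
          case False
          with less.IH[of "t' - y"] \<open>t = Suc t'\<close> show ?thesis by (simp del: funpow.simps)
        qed
        also have "\<dots> = q - (cumulate y ^^ Suc s) B t"
          by (simp add: cumulate.simps[of _ _ t])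
        finally show ?thesis .
      qed simp
    qed
  qed
qed

lemma need_le_iff:
  assumes "e * r < c" "0 \<le> r"
  shows "need m c r (e * r) \<le> b \<longleftrightarrow> (e + int (m - b)) * r < c"
  using assms
proof (induction m arbitrary: e)
  case (Suc m)
  have eq: "e * r + r = (e + 1) * r" by (simp add: algebra_simps)
  show ?case
  proof (cases "e * r + r < c")
    case True
    then have IH: "need m c r (e * r + r) \<le> b \<longleftrightarrow> (e + 1 + int (m - b)) * r < c"
      using Suc.IH[of "e + 1"] Suc.prems eq by simp
    show ?thesis
    proof (cases "b \<le> m")
      case le: True
      then have "e + int (Suc m - b) = e + 1 + int (m - b)" by simp
      with IH True show ?thesis by (simp only: need.simps if_True)
    next
      case False
      then have "m - b = 0" "Suc m - b = 0" by auto
      with IH True Suc.prems eq show ?thesis by simp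
    qed
  next
    case False
    show ?thesis
    proof (cases "b \<le> m")
      case True
      then have "(e + 1) * r \<le> (e + int (Suc m - b)) * r"
        using Suc.prems by (intro mult_right_mono) auto
      with True False eq show ?thesis by simp
    next
      case b: False
      then have "Suc m - b = 0" "Suc m \<le> b" by auto
      with False Suc.prems show ?thesis by simp
    qed
  qed
qed simp

text \<open>
  If no threshold is met, no number of further generators gives a violation: for the numbers that the
  list covers by the choice of the thresholds, and for all larger ones because the product of the two
  lower bounds only grows.
\<close>

lemma some_need_needs:
  assumes "\<not> some_need (needs f m c rm k n) s v" "0 \<le> k" "0 \<le> n"
    and v: "\<And>s q. minus_iter s v q = q - bound s"
  shows "c \<le> (k + int i + int (m - bound (s + i))) * max (n + int i) rm"
  using assms(1-3)
proof (induction f arbitrary: k n s i)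
  case 0
  then show ?case by simp
next
  case (Suc f)
  show ?case
  proof (cases "k * max n rm < c")
    case True
    show ?thesis
    proof (cases i)
      case 0
      have "\<not> need m c (max n rm) (k * max n rm) \<le> bound s"
        using Suc.prems(1) True by (simp add: v)
      with need_le_iff[OF True] Suc.prems 0 show ?thesis by (simp add: not_less)
    next
      case (Suc j)
      have "\<not> some_need (needs f m c rm (k + 1) (n + 1)) (Suc s) v"
        using Suc.prems(1) True by simp
      from Suc.IH[OF this, of j] Suc.prems Suc show ?thesis
        by (simp add: algebra_simps)
    qed
  next
    case False
    then have "c \<le> k * max n rm" by simp
    also have "\<dots> \<le> (k + int i + int (m - bound (s + i))) * max (n + int i) rm"
      using Suc.prems by (intro mult_mono) auto
    finally show ?thesis .
  qed
qed

lemma reach_le: "reach (window f x n) xi y c qs b r \<le> n"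
proof (induction n arbitrary: x xi y)
  case (Suc n)
  show ?case using Suc.IH[of "Suc x" "xi + 1" "Suc y"] by simp
qed simp

text \<open>
  Only the first excluded candidate needs to be known. The bound for generators not below it covers
  all later candidates.
\<close>

lemma reach_stop:
  assumes "d = reach (window f x n) (int x) y c qs b r" "d < n"
  shows "\<not> f (x + d) \<and> (c \<le> int (x + d) \<or> \<not> some_need qs 1 (strides (y + d) r 0 b))"
  using assms
proof (induction n arbitrary: x y d)
  case (Suc n)
  define D where "D = reach (window f (Suc x) n) (int (Suc x)) (Suc y) c qs b r"
  show ?case
  proof (cases "f x \<or> (int x < c \<and> some_need qs 1 (strides y r 0 b))")
    case True
    then have "d = Suc D" using Suc.prems(1) by (auto simp: D_def add.commute)
    with Suc.IH[OF D_def] Suc.prems(2) show ?thesis by simp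
  next
    case False
    then have "d = 0" using Suc.prems(1) by auto
    with False show ?thesis by auto
  qed
qed simp

section \<open>Soundness of the search\<close>

primrec lookup :: "entries \<Rightarrow> nat \<Rightarrow> (int \<times> nat) option" where
  "lookup Nil_e j = None"
| "lookup (Skip es) j = (case j of 0 \<Rightarrow> None | Suc j \<Rightarrow> lookup es j)"
| "lookup (Fail es) j = (case j of 0 \<Rightarrow> None | Suc j \<Rightarrow> lookup es j)"
| "lookup (Live c d es) j = (case j of 0 \<Rightarrow> Some (c, d) | Suc j \<Rightarrow> lookup es j)"

lemma lookup_skip_trim: "lookup (skip_trim es) j = (case j of 0 \<Rightarrow> None | Suc j \<Rightarrow> lookup es j)"
  by (cases es; cases j) simp_all

lemma lookup_tick: "lookup es j = Some (c, Suc d) \<Longrightarrow> lookup (tick es) j = Some (c, d)"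
proof (induction es arbitrary: j)
  case (Live c' d' es)
  then show ?case by (cases j; cases d') (auto simp: lookup_skip_trim)
qed (auto simp: lookup_skip_trim split: nat.splits)

lemma lookup_entry_Suc: "lookup (entry c prev L x y k m n b r es) (Suc j) = lookup es j"
  by (simp add: entry_def)

lemma no_fail_entry: "no_fail (entry c prev L x y k m n b r es) \<Longrightarrow> no_fail es"
  by (auto simp: entry_def split: if_splits)

lemma below_Suc: "below G (Suc i) = below G i + (if i \<in> G then 1 else 0)"
proof -
  have "{g \<in> G. g < Suc i} = (if i \<in> G then insert i {g \<in> G. g < i} else {g \<in> G. g < i})"
    by (auto simp: less_Suc_eq)
  then show ?thesis by (simp add: below_def)
qed

text \<open>
  The state of \<^const>\<open>scan\<close> at position $i$ of the monoid $G$ truncated at $N$.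
\<close>

definition scan_from ::
  "nat \<Rightarrow> nat set \<Rightarrow> nat \<Rightarrow> bits \<Rightarrow> int \<Rightarrow> nat \<Rightarrow> int \<Rightarrow> nat \<Rightarrow> entries \<Rightarrow> entries" where
  "scan_from m G N Lx x y k i es =
    scan es (window (\<lambda>i. i \<in> G) i (N - i)) (window (\<lambda>i. i \<in> G) (i + m) (N - (i + m)))
      (0 < i \<and> i - 1 \<in> G) Lx x y k m (int (below G i)) (hits m G (i + m)) (past (apery m G) (i + m))"

lemma scan_from_step:
  assumes "monoid_with m G" "i + m < N"
  shows "scan_from m G N Lx x y k i (Live c d es)
      = entry c (0 < i \<and> i - 1 \<in> G) Lx x y k m (int (below G i)) (hits m G (i + m))
          (past (apery m G) (i + m)) (scan_from m G N Lx x y k (Suc i) es)"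
    and "scan_from m G N Lx x y k i (Skip es) = Skip (scan_from m G N Lx x y k (Suc i) es)"
    and "scan_from m G N Lx x y k i (Fail es) = Skip (scan_from m G N Lx x y k (Suc i) es)"
proof -
  have ap: "apery m G (i + m) \<longleftrightarrow> i \<notin> G \<and> i + m \<in> G" by (auto simp: apery_def)
  have h: "hits m G (Suc (i + m)) = (if i \<notin> G \<and> i + m \<in> G then Suc (hits m G (i + m)) else hits m G (i + m))"
    using hits_Suc[OF assms(1), of "i + m"] ap by simp
  have p: "past (apery m G) (Suc (i + m)) =
      (if i \<notin> G \<and> i + m \<in> G then In (past (apery m G) (i + m)) else Out (past (apery m G) (i + m)))"
    using ap by simp
  have b: "int (below G (Suc i)) = (if i \<in> G then int (below G i) + 1 else int (below G i))"
    by (simp add: below_Suc)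
  have l: "window (\<lambda>i. i \<in> G) (Suc i) (N - i - 1) = window (\<lambda>i. i \<in> G) (Suc i) (N - Suc i)"
    "window (\<lambda>i. i \<in> G) (Suc (i + m)) (N - (i + m) - 1) = window (\<lambda>i. i \<in> G) (Suc i + m) (N - (Suc i + m))"
    by simp_all
  have hd: "hd_bits (window (\<lambda>i. i \<in> G) i (N - i)) = (i \<in> G)"
    "hd_bits (window (\<lambda>i. i \<in> G) (i + m) (N - (i + m))) = (i + m \<in> G)"
    using assms(2) by (auto simp: hd_bits_window)
  have S: "scan_from m G N Lx x y k (Suc i) es = scan es (window (\<lambda>i. i \<in> G) (Suc i) (N - i - 1))
     (window (\<lambda>i. i \<in> G) (Suc (i + m)) (N - (i + m) - 1)) (i \<in> G) Lx x y k m
     (if i \<in> G then int (below G i) + 1 else int (below G i))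
     (if i \<notin> G \<and> i + m \<in> G then Suc (hits m G (i + m)) else hits m G (i + m))
     (if i \<notin> G \<and> i + m \<in> G then In (past (apery m G) (i + m)) else Out (past (apery m G) (i + m)))"
    unfolding scan_from_def l b[symmetric] h[symmetric] p[symmetric] by simp
  show "scan_from m G N Lx x y k i (Live c d es)
      = entry c (0 < i \<and> i - 1 \<in> G) Lx x y k m (int (below G i)) (hits m G (i + m))
          (past (apery m G) (i + m)) (scan_from m G N Lx x y k (Suc i) es)"
    unfolding S by (simp only: scan_from_def scan.simps hd tl_bits_window)
  show "scan_from m G N Lx x y k i (Skip es) = Skip (scan_from m G N Lx x y k (Suc i) es)"
    unfolding S by (simp only: scan_from_def scan.simps hd tl_bits_window)
  show "scan_from m G N Lx x y k i (Fail es) = Skip (scan_from m G N Lx x y k (Suc i) es)"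
    unfolding S by (simp only: scan_from_def scan.simps hd tl_bits_window)
qed

lemma lookup_scan:
  assumes "monoid_with m G" "lookup es j = Some (int (i + j), d)" "i + j + m \<le> N"
    and "no_fail (scan_from m G N Lx x y k i es)"
    and "i + j = c" "\<not> (0 < c \<and> c - 1 \<in> G)" "k * int (below G c) < int c"
  shows "(60 < int c - int (below G c) \<or>
        hits m G (c + m) < need m (int c) (int (below G c)) (k * int (below G c))) \<and>
      lookup (scan_from m G N Lx x y k i es) j =
        Some (int c, reach Lx x y (int c)
          (needs 9 m (int c) (int c - 60) (k + 1) (int (below G c) + 1))
          (hits m G (c + m)) (past (apery m G) (c + m)))"
  using assms(2-5)
proof (induction es arbitrary: i j)
  case Nil_e
  then show ?case by simp
next
  case (Skip es)
  then obtain j' where j': "j = Suc j'" by (cases j) auto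
  with Skip.prems have "i + m < N" by simp
  note step = scan_from_step(2)[OF assms(1) this, of Lx x y k es]
  from Skip.IH[of j' "Suc i"] Skip.prems j' step show ?case by simp
next
  case (Fail es)
  then obtain j' where j': "j = Suc j'" by (cases j) auto
  with Fail.prems have "i + m < N" by simp
  note step = scan_from_step(3)[OF assms(1) this, of Lx x y k es]
  from Fail.IH[of j' "Suc i"] Fail.prems j' step show ?case by simp
next
  case (Live c' d' es)
  show ?case
  proof (cases j)
    case 0
    with Live.prems have c: "i = c" "c' = int c" by auto
    obtain es' where "scan_from m G N Lx x y k i (Live c' d' es) =
        entry (int c) (0 < c \<and> c - 1 \<in> G) Lx x y k m (int (below G c)) (hits m G (c + m))
          (past (apery m G) (c + m)) es'"
      unfolding scan_from_def scan.simps c by blast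
    with Live.prems(3) 0 assms(6,7) show ?thesis
      by (auto simp: entry_def not_less split: if_splits)
  next
    case (Suc j')
    with Live.prems have "i + m < N" by simp
    note step = scan_from_step(1)[OF assms(1) this, of Lx x y k c' d' es]
    with Live.IH[of j' "Suc i"] Live.prems Suc step no_fail_entry lookup_entry_Suc show ?thesis
      by simp
  qed
qed

lemma explore_child:
  assumes "explore (window f (Suc y) n) ch p L y x es" "lookup es c = Some (c', d)"
    and "y < z" "z \<le> y + d" "z \<le> y + n" "\<not> f z"
  shows "\<exists>es' d'. ch (adjoin_bits p z L) z (x + int (z - y)) es' \<and> lookup es' c = Some (c', d')"
  using assms
proof (induction n arbitrary: y x es d)
  case (Suc n)
  from Suc.prems obtain d' where d': "d = Suc d'" by (cases d) auto
  have tick: "lookup (tick es) c = Some (c', d')" using Suc.prems(2) d' by (simp add: lookup_tick)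
  then have "tick es \<noteq> Nil_e" by auto
  show ?case
  proof (cases "z = Suc y")
    case True
    with Suc.prems \<open>tick es \<noteq> Nil_e\<close> have "ch (adjoin_bits p z L) z (x + int (z - y)) (tick es)"
      by simp
    with tick show ?thesis by blast
  next
    case False
    have "explore (window f (Suc (Suc y)) n) ch p L (Suc y) (x + 1) (tick es)"
      using Suc.prems(1) \<open>tick es \<noteq> Nil_e\<close> by (auto split: if_splits)
    moreover have "x + 1 + int (z - Suc y) = x + int (z - y)" using Suc.prems False by simp
    ultimately show ?thesis
      using Suc.IH[of "Suc y" "x + 1" "tick es" d'] Suc.prems tick d' False by simp
  qed
qed simp

lemma past_cong: "(\<And>i. i < t \<Longrightarrow> f i = g i) \<Longrightarrow> past f t = past g t"
  by (induction t) auto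

lemma counts_hits: "monoid_with m G \<Longrightarrow> counts (apery m G) (hits m G)"
  by (simp add: counts_def hits_0 hits_Suc)

lemma below_extend_mono: "below G c \<le> below (extend G zs) c"
  unfolding below_def by (intro card_mono) (use extend_superset in auto)

text \<open>
  The search covers all independent sequences of generators above $y$. If the first generator is
  among the candidates, the child node applies to the remaining ones. Otherwise no generator lies
  below the first excluded candidate, and the residue bound together with the growth of the number
  of small elements gives the inequality without any further search.
\<close>

lemma node_sound:
  assumes "node f p m (past (\<lambda>i. i = 0) m) (int k) (window (\<lambda>i. i \<in> G) 0 N) y (int y + 1) es"
    and "monoid_with m G" "\<forall>g\<in>G. g < m \<longrightarrow> g = 0" "m \<le> y" "N \<le> 2 ^ p * m"
    and "lookup es c = Some (int c, d)" "0 < c" "c + m \<le> N"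
    and "sorted_wrt (<) zs" "\<forall>z\<in>set zs. y < z \<and> z < c" "independent G zs"
    and "c - 1 \<notin> extend G zs" "c \<le> 60 + below (extend G zs) c"
  shows "wilf_at m (k + length zs) (extend G zs) c"
  using assms
proof (induction f arbitrary: k G y es d zs)
  case 0
  then show ?case by simp
next
  case (Suc f)
  let ?L = "window (\<lambda>i. i \<in> G) 0 N"
  let ?Lx = "window (\<lambda>i. i \<in> G) (Suc y) (N - Suc y)"
  let ?es = "scan_from m G N ?Lx (int y + 1) y (int k) 0 es"
  let ?n = "int (below G c)" and ?n' = "int (below (extend G zs) c)"
  let ?b = "hits m G (c + m)" and ?b' = "hits m (extend G zs) (c + m)"
  note mono = Suc.prems(2)
  have m: "0 < m" and "0 \<in> G" using mono by (auto simp: monoid_with_def)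
  have low: "{g \<in> G. g < m} = {0}" using Suc.prems(3) m \<open>0 \<in> G\<close> by auto
  have "hits m G m = 1" unfolding hits_def low by simp
  moreover have "past (\<lambda>i. i = 0) m = past (apery m G) m"
    using low by (intro past_cong) (auto simp: apery_def)
  moreover have "below G 0 = 0" by (simp add: below_def)
  ultimately have es: "scan es ?L (drop_bits m ?L) False (drop_bits (Suc y) ?L) (int y + 1) y (int k) m 0 1
      (past (\<lambda>i. i = 0) m) = ?es"
    by (simp add: scan_from_def drop_bits_window)
  have nf: "no_fail ?es"
    and ex: "explore ?Lx (node f p m (past (\<lambda>i. i = 0) m) (int k + 1)) p ?L y (int y + 1) ?es"
    using Suc.prems(1) unfolding node.simps es by (auto simp: drop_bits_window)
  have n_le: "?n \<le> ?n'" using below_extend_mono by simp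
  show ?case
  proof (cases "int k * ?n < int c")
    case False
    then have "int c \<le> int k * ?n" by simp
    also have "\<dots> \<le> (int k + int (length zs + (m - ?b'))) * ?n'"
      using n_le by (intro mult_mono) auto
    finally have "int c \<le> int ((k + length zs + (m - ?b')) * below (extend G zs) c)"
      by (simp add: add.assoc)
    then show ?thesis unfolding wilf_at_def by (simp only: of_nat_le_iff)
  next
    case True
    have "\<not> (0 < c \<and> c - 1 \<in> G)" using Suc.prems(12) extend_superset[of G zs] by auto
    note scan = lookup_scan[OF mono, of es c 0 d N ?Lx "int y + 1" y "int k" c, simplified,
        OF Suc.prems(6) Suc.prems(8) nf this[simplified] True]
    define D where "D = reach ?Lx (int y + 1) y (int c)
          (needs 9 m (int c) (int c - 60) (int k + 1) (?n + 1)) ?b (past (apery m G) (c + m))"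
    have entry: "lookup ?es c = Some (int c, D)" using scan by (simp add: D_def)
    show ?thesis
    proof (cases zs)
      case Nil
      with Suc.prems(13) have "\<not> 60 < int c - ?n" by simp
      with scan have "\<not> need m (int c) ?n (int k * ?n) \<le> ?b" by simp
      with need_le_iff[OF True] have "int c \<le> (int k + int (m - ?b)) * ?n" by simp
      then have "int c \<le> int ((k + (m - ?b)) * below G c)" by simp
      then show ?thesis unfolding wilf_at_def by (simp only: of_nat_le_iff) (simp add: Nil)
    next
      case (Cons z zs')
      then have z: "y < z" "z < c" "z \<notin> G" using Suc.prems by auto
      show ?thesis
      proof (cases "z \<le> y + D")
        case le: True
        have "z \<le> y + (N - Suc y)" using z Suc.prems(8) m by linarith
        from explore_child[OF ex entry z(1) le this z(3)]
        obtain es' d' where child: "node f p m (past (\<lambda>i. i = 0) m) (int k + 1) (adjoin_bits p z ?L) z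
            (int y + 1 + int (z - y)) es'" "lookup es' c = Some (int c, d')" by blast
        have "m \<le> z" using z Suc.prems(4) by simp
        then have "2 ^ p * m \<le> 2 ^ p * z" by simp
        with Suc.prems(5) have "N \<le> 2 ^ p * z" by linarith
        then have adj: "adjoin_bits p z ?L = window (\<lambda>i. i \<in> adjoin G z) 0 N"
          by (rule adjoin_bits_adjoin)
        have low': "\<forall>g\<in>adjoin G z. g < m \<longrightarrow> g = 0"
        proof (intro ballI impI)
          fix g assume g: "g \<in> adjoin G z" "g < m"
          show "g = 0"
          proof (cases "g \<in> G")
            case False
            from adjoin_cases[OF g(1) this] obtain h where "g = z + h" .
            with g \<open>m \<le> z\<close> show ?thesis by simp
          qed (use g Suc.prems(3) in auto)
        qed
        have "wilf_at m (k + 1 + length zs') (extend (adjoin G z) zs') c"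
        proof (rule Suc.IH[OF _ _ low' _ Suc.prems(5) child(2) Suc.prems(7,8)])
          show "node f p m (past (\<lambda>i. i = 0) m) (int (k + 1)) (window (\<lambda>i. i \<in> adjoin G z) 0 N) z
            (int z + 1) es'"
            using child(1) z(1) by (simp add: adj add.commute)
        qed (use Suc.prems Cons z \<open>m \<le> z\<close> adjoin_monoid in auto)
        then show ?thesis by (simp add: Cons)
      next
        case False
        have "D < N - Suc y" using False z Suc.prems(8) m by linarith
        have "D = reach ?Lx (int (Suc y)) y (int c)
          (needs 9 m (int c) (int c - 60) (int k + 1) (?n + 1)) ?b (past (apery m G) (c + m))"
          by (simp add: D_def add.commute)
        from reach_stop[OF this \<open>D < N - Suc y\<close>] False z
        have stop: "\<not> some_need (needs 9 m (int c) (int c - 60) (int k + 1) (?n + 1)) 1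
            (strides (y + D) (past (apery m G) (c + m)) 0 ?b)" by auto
        let ?s = "length zs"
        define B where "B s = (cumulate (y + D) ^^ s) (hits m G) (c + m)" for s
        have s: "1 + length zs' = ?s" by (simp add: Cons)
        have "int c \<le> (int k + 1 + int (length zs') + int (m - B (1 + length zs')))
            * max (?n + 1 + int (length zs')) (int c - 60)"
          by (rule some_need_needs[OF stop])
            (auto simp: minus_iter_strides[OF counts_hits[OF mono]] B_def)
        also have "\<dots> \<le> (int k + int ?s + int (m - ?b')) * ?n'"
        proof (rule mult_mono)
          have "\<forall>x\<in>set zs. y + D < x"
            using Suc.prems(9) False Cons by auto
          from hits_extend[OF mono this] have "?b' \<le> B ?s" by (simp add: B_def)
          then show "int k + 1 + int (length zs') + int (m - B (1 + length zs'))
              \<le> int k + int ?s + int (m - ?b')"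
            unfolding s by (simp add: Cons)
          have "below G c + ?s \<le> below (extend G zs) c"
            using below_extend[OF Suc.prems(11) _ mono] Suc.prems(10) by blast
          with Suc.prems(13) show "max (?n + 1 + int (length zs')) (int c - 60) \<le> ?n'"
            by (simp add: Cons)
        qed auto
        finally have "int c \<le> int ((k + ?s + (m - ?b')) * below (extend G zs) c)" by simp
        then show ?thesis unfolding wilf_at_def by (simp only: of_nat_le_iff)
      qed
    qed
  qed
qed

lemma lookup_fresh: "j < n \<Longrightarrow> lo \<le> j \<Longrightarrow> lookup (fresh lo c n) j = Some (c + int j, 0)"
proof (induction n arbitrary: lo c j)
  case (Suc n)
  then show ?case by (cases j; cases lo) (auto simp: add.assoc)
qed simp

lemma multiples_bits_window:
  "i \<le> y \<Longrightarrow> Suc y dvd a + i \<Longrightarrow> multiples_bits y i n = window (\<lambda>g. Suc y dvd g) a n"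
proof (induction n arbitrary: a i)
  case (Suc n)
  show ?case
  proof (cases i)
    case 0
    have "Suc y dvd Suc a + y" using Suc.prems 0 dvd_add[of "Suc y" a "Suc y"] by simp
    with 0 Suc show ?thesis by simp
  next
    case (Suc j)
    have "\<not> Suc y dvd a"
    proof
      assume "Suc y dvd a"
      with Suc.prems(2) have "Suc y dvd i" by (simp add: dvd_add_right_iff)
      with Suc.prems(1) Suc show False by (auto dest: dvd_imp_le)
    qed
    with Suc Suc.prems Suc.IH[of j "Suc a"] show ?thesis by simp
  qed
qed simp

lemma run_sound:
  assumes "run p lo hi m" "0 < m" "hi + m \<le> 2 ^ p * m" "lo \<le> c" "2 * m < c" "c < hi"
    and "sorted_wrt (<) zs" "\<forall>z\<in>set zs. m < z \<and> z < c" "independent {g. m dvd g} zs"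
    and "c - 1 \<notin> extend {g. m dvd g} zs" "c \<le> 60 + below (extend {g. m dvd g} zs) c"
  shows "wilf_at m (1 + length zs) (extend {g. m dvd g} zs) c"
proof (rule node_sound[where p = p and N = "hi + m" and y = m and d = 0])
  have "multiples_bits (m - 1) 0 (hi + m) = window (\<lambda>g. m dvd g) 0 (hi + m)"
    using multiples_bits_window[of 0 "m - 1" 0 "hi + m"] assms(2) by simp
  then show "node 9 p m (past (\<lambda>i. i = 0) m) (int 1) (window (\<lambda>i. i \<in> {g. m dvd g}) 0 (hi + m)) m
     (int m + 1) (fresh (max lo (2 * m + 1)) 0 hi)"
    using assms(1) by (simp add: run_def)
  show "lookup (fresh (max lo (2 * m + 1)) 0 hi) c = Some (int c, 0)"
    using assms lookup_fresh[of c hi "max lo (2 * m + 1)" 0] by simp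
qed (use assms in \<open>auto simp: monoid_with_def dest: dvd_imp_le\<close>)

section \<open>Semigroups as extensions of the multiples of the multiplicity\<close>

lemma adjoin_subset: "monoid_with m S \<Longrightarrow> G \<subseteq> S \<Longrightarrow> z \<in> S \<Longrightarrow> adjoin G z \<subseteq> S"
  by (auto simp: adjoin_def intro: monoid_with_mult)

lemma extend_subset: "monoid_with m S \<Longrightarrow> G \<subseteq> S \<Longrightarrow> set zs \<subseteq> S \<Longrightarrow> extend G zs \<subseteq> S"
  by (induction zs arbitrary: G) (auto dest: adjoin_subset)

lemma Irr_adjoin:
  assumes "g \<in> Irr S" "g \<in> adjoin G z" "adjoin G z \<subseteq> S" "z \<in> S" "z \<noteq> 0"
  shows "g \<in> G \<or> g = z"
proof (rule ccontr)
  assume neg: "\<not> (g \<in> G \<or> g = z)"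
  then obtain h where h: "g = z + h" "h \<in> adjoin G z" using adjoin_cases assms(2) by metis
  with neg assms have "h \<in> S" "h \<noteq> 0" by auto
  with h(1) assms show False unfolding Irr_def by blast
qed

lemma independent_Irr:
  assumes "monoid_with m S" "G \<subseteq> S" "set zs \<subseteq> Irr S" "distinct zs" "set zs \<inter> G = {}"
  shows "independent G zs"
  using assms
proof (induction zs arbitrary: G)
  case (Cons z zs)
  have "z \<in> S" "z \<noteq> 0" using Cons.prems by (auto simp: Irr_def)
  moreover have "adjoin G z \<subseteq> S" using Cons.prems \<open>z \<in> S\<close> by (intro adjoin_subset) auto
  ultimately have "set zs \<inter> adjoin G z = {}"
    using Irr_adjoin[of _ S G z] Cons.prems(3-5) by (simp add: disjoint_iff) blast
  with Cons \<open>adjoin G z \<subseteq> S\<close> show ?case by auto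
qed simp

locale semigroup_data =
  fixes S :: "nat set" and m c :: nat
  assumes semigroup: "numerical_semigroup S"
    and m: "m \<in> S" "0 < m" "\<And>s. s \<in> S \<Longrightarrow> s \<noteq> 0 \<Longrightarrow> m \<le> s"
    and c: "0 < c" "c - 1 \<notin> S" "\<And>x. c \<le> x \<Longrightarrow> x \<in> S"
begin

lemma monoid_S: "monoid_with m S"
  using semigroup m by (auto simp: monoid_with_def numerical_semigroup_def)

lemma decompose:
  assumes "h \<in> S" "h \<noteq> 0" "h \<notin> Irr S"
  obtains a b where "a \<in> S" "b \<in> S" "m \<le> a" "m \<le> b" "h = a + b"
  using assms m(3) that by (auto simp: Irr_def)

lemma genus_eq: "genus S + below S c = c"
proof -
  have "UNIV - S = {..<c} - {g \<in> S. g < c}" using c(3) not_le by auto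
  moreover have "card ({..<c} - {g \<in> S. g < c}) = c - below S c"
    unfolding below_def by (subst card_Diff_subset) auto
  moreover have "below S c \<le> card {..<c}" unfolding below_def by (intro card_mono) auto
  ultimately show ?thesis by (simp add: genus_def)
qed

lemma m_le_c: "m \<le> c"
proof (rule ccontr)
  assume "\<not> m \<le> c"
  then show False using c(1) c(3)[of c] m(3)[of c] by auto
qed

text \<open>
  If $c \le 2m$, every non-zero element below $c$ is irreducible, say there are $k$ of them, and
  the decomposable elements of $[c, c + m)$ are sums of two of them, so there are
  $d \le k (k + 1) / 2$. Hence $(k + m - d)(k + 1) \ge 2d + 2(m - d) = 2m$ if $k > 0$.
\<close>

lemma wilf_low:
  assumes "c \<le> 2 * m"
  shows "c \<le> card (Irr S) * below S c"
proof -
  define A where "A = {x \<in> S. m \<le> x \<and> x < c}"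
  define D where "D = (\<lambda>(a, b). a + b) ` {(a, b). a \<in> A \<and> b \<in> A \<and> a \<le> b} \<inter> {c..<c + m}"
  define k where "k = card A"
  have fin: "finite A" "finite D" unfolding A_def D_def by auto
  have "{x \<in> S. x < c} = insert 0 A"
    using m(3) c(1) monoid_S by (auto simp: A_def monoid_with_def)
  then have n: "below S c = k + 1" using m(2) fin by (simp add: below_def k_def A_def)
  have "A \<subseteq> Irr S"
  proof
    fix x assume x: "x \<in> A"
    show "x \<in> Irr S"
    proof (rule ccontr)
      assume "x \<notin> Irr S"
      then obtain a b where "m \<le> a" "m \<le> b" "x = a + b"
        using x m(2) by (auto simp: A_def elim: decompose[of x])
      with x assms show False by (auto simp: A_def)
    qed
  qed
  moreover have "{c..<c + m} - D \<subseteq> Irr S"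
  proof
    fix x assume x: "x \<in> {c..<c + m} - D"
    show "x \<in> Irr S"
    proof (rule ccontr)
      assume "x \<notin> Irr S"
      moreover have "x \<in> S" "x \<noteq> 0" using x c by auto
      ultimately obtain a b where ab: "a \<in> S" "b \<in> S" "m \<le> a" "m \<le> b" "x = a + b"
        using decompose by blast
      with x have "a \<in> A" "b \<in> A" by (auto simp: A_def)
      then have "(min a b, max a b) \<in> {(a, b). a \<in> A \<and> b \<in> A \<and> a \<le> b}" by (auto simp: min_def max_def)
      moreover have "x = (\<lambda>(a, b). a + b) (min a b, max a b)" using ab by (simp add: min_def max_def)
      ultimately have "x \<in> (\<lambda>(a, b). a + b) ` {(a, b). a \<in> A \<and> b \<in> A \<and> a \<le> b}"
        by (rule rev_image_eqI)
      with x have "x \<in> D" unfolding D_def by blast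
      with x show False by simp
    qed
  qed
  ultimately have "A \<union> ({c..<c + m} - D) \<subseteq> Irr S" by blast
  then have "card (A \<union> ({c..<c + m} - D)) \<le> card (Irr S)"
    using finite_Irr[OF semigroup] by (rule card_mono[rotated])
  moreover have "card (A \<union> ({c..<c + m} - D)) = k + card ({c..<c + m} - D)"
    unfolding k_def by (rule card_Un_disjoint) (use fin in \<open>auto simp: A_def\<close>)
  moreover have "card ({c..<c + m} - D) = m - card D"
    by (subst card_Diff_subset) (use fin in \<open>auto simp: D_def\<close>)
  ultimately have e: "k + (m - card D) \<le> card (Irr S)" by simp
  have "card D \<le> card {c..<c + m}" by (intro card_mono) (auto simp: D_def)
  then have Dm: "card D \<le> m" by simp
  \<comment> \<open>Unordered pairs: both orders together cover the square, and share the diagonal.\<close>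
  have pairs: "2 * card {(a, b). a \<in> A \<and> b \<in> A \<and> a \<le> b} \<le> k * (k + 1)"
  proof -
    let ?P = "{(a, b). a \<in> A \<and> b \<in> A \<and> a \<le> b}" and ?Q = "{(a, b). a \<in> A \<and> b \<in> A \<and> b \<le> a}"
    have finPQ: "finite ?P" "finite ?Q"
      by (rule finite_subset[of _ "A \<times> A"]; use fin in auto)+
    have "?P \<union> ?Q = A \<times> A" "?P \<inter> ?Q = (\<lambda>a. (a, a)) ` A" by auto
    moreover have "card ((\<lambda>a. (a, a)) ` A) = k"
      unfolding k_def by (rule card_image) (auto simp: inj_on_def)
    moreover have "card (A \<times> A) = k * k" by (simp add: k_def card_cartesian_product)
    moreover have "card ?Q = card ?P"
      by (rule bij_betw_same_card[of "\<lambda>(a, b). (b, a)"])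
        (auto simp: bij_betw_def inj_on_def image_def)
    ultimately show ?thesis using card_Un_Int[OF finPQ] by simp
  qed
  have finP: "finite {(a, b). a \<in> A \<and> b \<in> A \<and> a \<le> b}"
    by (rule finite_subset[of _ "A \<times> A"]) (use fin in auto)
  have "card D \<le> card ((\<lambda>(a, b). a + b) ` {(a, b). a \<in> A \<and> b \<in> A \<and> a \<le> b})"
    unfolding D_def by (rule card_mono[OF finite_imageI[OF finP] Int_lower1])
  also have "\<dots> \<le> card {(a, b). a \<in> A \<and> b \<in> A \<and> a \<le> b}"
    by (rule card_image_le[OF finP])
  finally have D: "2 * card D \<le> k * (k + 1)" using pairs by linarith
  have "c \<le> (k + (m - card D)) * (k + 1)"
  proof (cases k)
    case 0
    then have "A = {}" using fin by (simp add: k_def)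
    then have "\<not> m < c" using m(1) by (auto simp: A_def)
    moreover have "card D = 0" using D 0 by simp
    ultimately show ?thesis using 0 by simp
  next
    case (Suc k')
    have "c \<le> 2 * card D + 2 * (m - card D)" using assms Dm by simp
    also have "\<dots> \<le> k * (k + 1) + (m - card D) * (k + 1)"
      using D Suc by (intro add_mono) auto
    finally show ?thesis by (simp add: algebra_simps)
  qed
  also have "\<dots> \<le> card (Irr S) * below S c" using e n by (intro mult_mono) auto
  finally show ?thesis .
qed

text \<open>
  The path through the search tree that leads from the multiples of $m$ to the monoid generated by
  the irreducible elements below $c$.
\<close>

definition left_irr :: "nat list" where
  "left_irr = sorted_list_of_set {x \<in> Irr S. m < x \<and> x < c}"

definition left_span :: "nat set" where
  "left_span = extend {g. m dvd g} left_irr"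

lemma set_left_irr: "set left_irr = {x \<in> Irr S. m < x \<and> x < c}"
  by (simp add: left_irr_def)

lemma multiples: "monoid_with m {g. m dvd g}" "{g. m dvd g} \<subseteq> S"
proof -
  show "monoid_with m {g. m dvd g}" using m(2) by (auto simp: monoid_with_def)
  show "{g. m dvd g} \<subseteq> S"
  proof
    fix g assume "g \<in> {g. m dvd g}"
    then obtain i where "g = m * i" by (auto simp: dvd_def)
    then have "g = 0 + i * m" by simp
    with monoid_with_mult[OF monoid_S, of 0 m i] m(1) monoid_S show "g \<in> S"
      by (simp add: monoid_with_def)
  qed
qed

lemma left_span_monoid: "monoid_with m left_span"
  unfolding left_span_def by (rule extend_monoid) (rule multiples)

lemma left_span_subset: "left_span \<subseteq> S"
  unfolding left_span_def
  by (rule extend_subset[OF monoid_S multiples(2)]) (auto simp: set_left_irr Irr_def)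

lemma left_span_low: "s \<in> S \<Longrightarrow> s < c \<Longrightarrow> s \<in> left_span"
proof (induction s rule: less_induct)
  case (less s)
  show ?case
  proof (cases "s = 0 \<or> s \<notin> Irr S")
    case True
    show ?thesis
    proof (cases "s = 0")
      case False
      with True less.prems obtain a b where "a \<in> S" "b \<in> S" "m \<le> a" "m \<le> b" "s = a + b"
        using decompose by blast
      with less m(2) have "a \<in> left_span" "b \<in> left_span" by auto
      with \<open>s = a + b\<close> left_span_monoid show ?thesis by (simp add: monoid_with_def)
    qed (use left_span_monoid in \<open>simp add: monoid_with_def\<close>)
  next
    case False
    then have "m \<le> s" using m(3) less.prems by auto
    show ?thesis
    proof (cases "s = m")
      case True
      with left_span_monoid show ?thesis by (simp add: monoid_with_def)
    next
      case s: False
      with False \<open>m \<le> s\<close> less.prems have "s \<in> set left_irr" by (simp add: set_left_irr)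
      then show ?thesis unfolding left_span_def by (rule mem_extend[OF multiples(1)])
    qed
  qed
qed

lemma below_left_span: "below left_span c = below S c"
  unfolding below_def using left_span_subset left_span_low by (intro arg_cong[of _ _ card]) auto

lemma independent_left: "independent {g. m dvd g} left_irr"
proof (rule independent_Irr[OF monoid_S multiples(2)])
  show "set left_irr \<inter> {g. m dvd g} = {}"
  proof -
    have False if x: "x \<in> Irr S" "m < x" "m dvd x" for x
    proof -
      have "x = m + (x - m)" "x - m \<noteq> 0" using x(2) by simp_all
      moreover have "x - m \<in> {g. m dvd g}" using x(3) by simp
      then have "x - m \<in> S" using multiples(2) by blast
      moreover have "x \<noteq> a + b" if "a \<in> S" "b \<in> S" "a \<noteq> 0" "b \<noteq> 0" for a b
        using x(1) that by (auto simp: Irr_def)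
      ultimately show False using m(1,2) \<open>x = m + (x - m)\<close> by blast
    qed
    then show ?thesis by (auto simp: set_left_irr)
  qed
qed (auto simp: set_left_irr, simp add: left_irr_def)

text \<open>
  A sum of two non-zero elements that is below $c + m$ has both summands below $c$, hence in the span
  of the irreducible elements below $c$. Everything in $[c, c + m)$ outside this span is irreducible.
\<close>

lemma card_Irr_ge:
  assumes "m < c"
  shows "1 + length left_irr + (m - hits m left_span (c + m)) \<le> card (Irr S)"
proof -
  let ?D = "{h \<in> left_span. c \<le> h \<and> h < c + m}"
  have "{c..<c + m} - ?D \<subseteq> Irr S"
  proof
    fix h assume h: "h \<in> {c..<c + m} - ?D"
    show "h \<in> Irr S"
    proof (rule ccontr)
      assume "h \<notin> Irr S"
      moreover have "h \<in> S" "h \<noteq> 0" using h c by auto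
      ultimately obtain a b where ab: "a \<in> S" "b \<in> S" "m \<le> a" "m \<le> b" "h = a + b"
        using decompose by blast
      from h ab(3-5) have "a < c" "b < c" by auto
      with ab(1,2) have "a \<in> left_span" "b \<in> left_span" by (simp_all add: left_span_low)
      with ab(5) left_span_monoid have "h \<in> left_span" by (simp add: monoid_with_def)
      with h show False by auto
    qed
  qed
  moreover have "m \<in> Irr S"
  proof (rule ccontr)
    assume "m \<notin> Irr S"
    with m(1,2) obtain a b where "m \<le> a" "m \<le> b" "m = a + b" using decompose[of m] by blast
    with m(2) show False by simp
  qed
  moreover have "set left_irr \<subseteq> Irr S" by (auto simp: set_left_irr)
  ultimately have "insert m (set left_irr) \<union> ({c..<c + m} - ?D) \<subseteq> Irr S" by blast
  then have "card (insert m (set left_irr) \<union> ({c..<c + m} - ?D)) \<le> card (Irr S)"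
    using finite_Irr[OF semigroup] by (rule card_mono[rotated])
  moreover have "card (insert m (set left_irr) \<union> ({c..<c + m} - ?D))
      = card (insert m (set left_irr)) + card ({c..<c + m} - ?D)"
    by (rule card_Un_disjoint) (use assms in \<open>auto simp: set_left_irr\<close>)
  moreover have "card (insert m (set left_irr)) = 1 + length left_irr"
    by (simp add: set_left_irr) (simp add: left_irr_def)
  moreover have "card ({c..<c + m} - ?D) = m - card ?D"
    by (subst card_Diff_subset) auto
  moreover have "card ?D \<le> hits m left_span (c + m)"
  proof -
    have "inj_on (\<lambda>g. g mod m) ?D"
    proof (rule inj_onI)
      fix g h assume gh: "g \<in> ?D" "h \<in> ?D" "g mod m = h mod m"
      have "g = h" if "g \<le> h" "g mod m = h mod m" "h < g + m" for g h
      proof -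
        from that obtain q where "h = g + m * q" by (metis mod_eq_nat1E)
        with that show "g = h" by (cases q) auto
      qed
      note eq = this
      have "c \<le> g" "g < c + m" "c \<le> h" "h < c + m" using gh(1,2) by simp_all
      then have "h < g + m" "g < h + m" by linarith+
      with eq[of g h] eq[of h g] gh(3) show "g = h" by (cases "g \<le> h") simp_all
    qed
    then have "card ?D = card ((\<lambda>g. g mod m) ` ?D)" by (rule card_image[symmetric])
    also have "\<dots> \<le> hits m left_span (c + m)"
      unfolding hits_def by (intro card_mono) auto
    finally show ?thesis .
  qed
  ultimately show ?thesis by linarith
qed

text \<open>
  This reduces the problem to finitely many conductors: if at least half of the numbers below $c$ are
  elements, two irreducible elements suffice.
\<close>

lemma wilf_many:
  assumes "m < c" "1 < m" "genus S \<le> below S c"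
  shows "c \<le> card (Irr S) * below S c"
proof -
  have "2 \<le> 1 + length left_irr + (m - hits m left_span (c + m))"
  proof (cases left_irr)
    case Nil
    have "(\<lambda>g. g mod m) ` {g \<in> {g. m dvd g}. g < c + m} \<subseteq> {0}" by auto
    then have "hits m left_span (c + m) \<le> card {0::nat}"
      unfolding left_span_def Nil extend.simps hits_def by (rule card_mono[rotated]) simp
    with assms show ?thesis by simp
  qed simp
  with card_Irr_ge[OF assms(1)] have "2 * below S c \<le> card (Irr S) * below S c"
    by (intro mult_right_mono) auto
  with genus_eq assms(3) show ?thesis by linarith
qed

lemma wilf_run:
  assumes "run p lo hi m" "hi + m \<le> 2 ^ p * m" "lo \<le> c" "2 * m < c" "c < hi" "genus S \<le> 60"
  shows "c \<le> card (Irr S) * below S c"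
proof -
  have "wilf_at m (1 + length left_irr) left_span c"
    unfolding left_span_def
  proof (rule run_sound[OF assms(1) m(2) assms(2-5) _ _ independent_left])
    show "sorted_wrt (<) left_irr" by (simp add: left_irr_def strict_sorted_iff)
    show "\<forall>z\<in>set left_irr. m < z \<and> z < c" by (simp add: set_left_irr)
    show "c - 1 \<notin> extend {g. m dvd g} left_irr"
      using left_span_subset c(2) unfolding left_span_def by blast
    show "c \<le> 60 + below (extend {g. m dvd g} left_irr) c"
      using genus_eq assms(6) below_left_span unfolding left_span_def by simp
  qed
  then have "c \<le> (1 + length left_irr + (m - hits m left_span (c + m))) * below S c"
    by (simp add: wilf_at_def below_left_span)
  also have "\<dots> \<le> card (Irr S) * below S c"
    using card_Irr_ge assms(4) by (intro mult_right_mono) auto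
  finally show ?thesis .
qed

end

section \<open>Evaluation of the search\<close>

lemma run_of_runs: "runs p lo hi [a..<b] \<Longrightarrow> a \<le> m \<Longrightarrow> m < b \<Longrightarrow> run p lo hi m"
proof -
  have "runs p lo hi ms \<Longrightarrow> m \<in> set ms \<Longrightarrow> run p lo hi m" for ms
    by (induction ms) auto
  then show "runs p lo hi [a..<b] \<Longrightarrow> a \<le> m \<Longrightarrow> m < b \<Longrightarrow> run p lo hi m" by simp
qed

text \<open>
  The search proper. It is split by the multiplicity $m$, since the number $p$ of doublings that covers
  all numbers below $hi + m$ depends on $m$, and by the conductor: beyond 90 hardly anything has to be
  searched, and the shorter strings for $c < 90$ are cheaper.
\<close>

lemma runs_90_2: "runs 6 0 90 [2..<3]"
  by code_simp

lemma runs_90_3: "runs 5 0 90 [3..<6]"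
  by code_simp

lemma runs_90_6: "runs 4 0 90 [6..<10]"
  by code_simp

lemma runs_90_10: "runs 4 0 90 [10..<13]"
  by code_simp

lemma runs_90_13: "runs 3 0 90 [13..<15]"
  by code_simp

lemma runs_90_15: "runs 3 0 90 [15..<17]"
  by code_simp

lemma runs_90_17: "runs 3 0 90 [17..<19]"
  by code_simp

lemma runs_90_19: "runs 3 0 90 [19..<21]"
  by code_simp

lemma runs_90_21: "runs 3 0 90 [21..<23]"
  by code_simp

lemma runs_90_23: "runs 3 0 90 [23..<26]"
  by code_simp

lemma runs_90_26: "runs 3 0 90 [26..<30]"
  by code_simp

lemma runs_90_30: "runs 2 0 90 [30..<45]"
  by code_simp

lemma runs_120_2: "runs 6 90 120 [2..<4]"
  by code_simp

lemma runs_120_4: "runs 5 90 120 [4..<8]"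
  by code_simp

lemma runs_120_8: "runs 4 90 120 [8..<18]"
  by code_simp

lemma runs_120_18: "runs 3 90 120 [18..<40]"
  by code_simp

lemma runs_120_40: "runs 2 90 120 [40..<60]"
  by code_simp

lemma run_below_90:
  assumes "2 \<le> m" "m < 45"
  shows "\<exists>p. run p 0 90 m \<and> 90 + m \<le> 2 ^ p * m"
proof -
  consider "2 \<le> m" "m < 3" | "3 \<le> m" "m < 6" | "6 \<le> m" "m < 10" | "10 \<le> m" "m < 13" | "13 \<le> m" "m < 15" | "15 \<le> m" "m < 17" | "17 \<le> m" "m < 19" | "19 \<le> m" "m < 21" | "21 \<le> m" "m < 23" | "23 \<le> m" "m < 26" | "26 \<le> m" "m < 30" | "30 \<le> m" "m < 45"
    using assms by linarith
  then show ?thesis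
  proof cases
    case 1
    from run_of_runs[OF runs_90_2 this] this show ?thesis by (intro exI[of _ 6]) simp
  next
    case 2
    from run_of_runs[OF runs_90_3 this] this show ?thesis by (intro exI[of _ 5]) simp
  next
    case 3
    from run_of_runs[OF runs_90_6 this] this show ?thesis by (intro exI[of _ 4]) simp
  next
    case 4
    from run_of_runs[OF runs_90_10 this] this show ?thesis by (intro exI[of _ 4]) simp
  next
    case 5
    from run_of_runs[OF runs_90_13 this] this show ?thesis by (intro exI[of _ 3]) simp
  next
    case 6
    from run_of_runs[OF runs_90_15 this] this show ?thesis by (intro exI[of _ 3]) simp
  next
    case 7
    from run_of_runs[OF runs_90_17 this] this show ?thesis by (intro exI[of _ 3]) simp
  next
    case 8
    from run_of_runs[OF runs_90_19 this] this show ?thesis by (intro exI[of _ 3]) simp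
  next
    case 9
    from run_of_runs[OF runs_90_21 this] this show ?thesis by (intro exI[of _ 3]) simp
  next
    case 10
    from run_of_runs[OF runs_90_23 this] this show ?thesis by (intro exI[of _ 3]) simp
  next
    case 11
    from run_of_runs[OF runs_90_26 this] this show ?thesis by (intro exI[of _ 3]) simp
  next
    case 12
    from run_of_runs[OF runs_90_30 this] this show ?thesis by (intro exI[of _ 2]) simp
  qed
qed

lemma run_from_90:
  assumes "2 \<le> m" "m < 60"
  shows "\<exists>p. run p 90 120 m \<and> 120 + m \<le> 2 ^ p * m"
proof -
  consider "2 \<le> m" "m < 4" | "4 \<le> m" "m < 8" | "8 \<le> m" "m < 18" | "18 \<le> m" "m < 40" | "40 \<le> m" "m < 60"
    using assms by linarith
  then show ?thesis
  proof cases
    case 1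
    from run_of_runs[OF runs_120_2 this] this show ?thesis by (intro exI[of _ 6]) simp
  next
    case 2
    from run_of_runs[OF runs_120_4 this] this show ?thesis by (intro exI[of _ 5]) simp
  next
    case 3
    from run_of_runs[OF runs_120_8 this] this show ?thesis by (intro exI[of _ 4]) simp
  next
    case 4
    from run_of_runs[OF runs_120_18 this] this show ?thesis by (intro exI[of _ 3]) simp
  next
    case 5
    from run_of_runs[OF runs_120_40 this] this show ?thesis by (intro exI[of _ 2]) simp
  qed
qed

theorem mainTheorem2:
  fixes S :: "nat set"
  assumes "numerical_semigroup S" and "genus S \<le> 60"
  shows "real (card (Irr S)) \<ge> real_of_int (conductor S) / (real_of_int (conductor S) - real (genus S))"
proof (cases "S = UNIV")
  case True
  then show ?thesis by (simp add: conductor_UNIV)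
next
  note S = assms(1)
  case False
  then obtain x where x: "x \<notin> S" by blast
  have "int x \<notin> int ` S" using x by auto
  then have "0 \<le> frobenius S" using frobenius_is_greatest(2)[OF S] by fastforce
  then obtain c' where c': "frobenius S = int c'" using nonneg_int_cases by blast
  define c where "c = Suc c'"
  have cond: "conductor S = int c" by (simp add: conductor_def c' c_def)
  have "c - 1 \<notin> S" using frobenius_is_greatest(1)[OF S] c' c_def by auto
  have above: "y \<in> S" if "c \<le> y" for y
  proof (rule ccontr)
    assume "y \<notin> S"
    then have "int y \<notin> int ` S" by auto
    from frobenius_is_greatest(2)[OF S this] c' c_def that show False by simp
  qed
  define m where "m = (LEAST s. s \<in> S \<and> s \<noteq> 0)"
  have "c \<in> S \<and> c \<noteq> 0" using above c_def by simp
  then have m: "m \<in> S \<and> m \<noteq> 0" unfolding m_def by (rule LeastI)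
  have m_le: "m \<le> s" if "s \<in> S" "s \<noteq> 0" for s
    unfolding m_def using that by (intro Least_le) simp
  interpret semigroup_data S m c
    using S m m_le above \<open>c - 1 \<notin> S\<close> c_def by unfold_locales auto
  have "0 \<in> S" using S by (simp add: numerical_semigroup_def)
  have "m \<noteq> 1"
  proof
    assume "m = 1"
    with multiples(2) have "S = UNIV" by auto
    with False show False by simp
  qed
  with m have "2 \<le> m" by simp
  have "0 < below S c" unfolding below_def using \<open>0 \<in> S\<close> c(1) by (auto simp: card_gt_0_iff)
  have "c \<le> card (Irr S) * below S c"
  proof (cases "c \<le> 2 * m \<or> genus S \<le> below S c")
    case True
    show ?thesis
    proof (cases "c \<le> 2 * m")
      case False
      with True \<open>2 \<le> m\<close> show ?thesis by (intro wilf_many) auto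
    qed (rule wilf_low)
  next
    case False
    with genus_eq assms(2) have c: "2 * m < c" "c < 120" by auto
    show ?thesis
    proof (cases "c < 90")
      case True
      with c have "m < 45" by simp
      with run_below_90[OF \<open>2 \<le> m\<close>] obtain p where "run p 0 90 m" "90 + m \<le> 2 ^ p * m" by blast
      with True c assms(2) show ?thesis by (intro wilf_run) auto
    next
      case c90: False
      from c have "m < 60" by simp
      with run_from_90[OF \<open>2 \<le> m\<close>] obtain p where "run p 90 120 m" "120 + m \<le> 2 ^ p * m" by blast
      with c90 c assms(2) show ?thesis by (intro wilf_run[of p 90 120]) auto
    qed
  qed
  then have "real c \<le> real (card (Irr S)) * real (below S c)"
    by (metis of_nat_le_iff of_nat_mult)
  moreover have "real_of_int (conductor S) - real (genus S) = real (below S c)"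
    using genus_eq cond by simp
  ultimately show ?thesis
    using \<open>0 < below S c\<close> cond by (simp add: divide_le_eq)
qed

end
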